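(* Let $\mu:G\times H\to K$ be a graph homomorphism, where $K$ is square-free and $G$ and $H$ are connected and non-bipartite. Then there are graph homomorphisms $\mu^*:G\times H\to K$, $\gamma:G\times H\to I$ and $\delta:I\to K$ such that $\mu^*=\delta\circ\gamma$ and $\mu^*$ is reachable from $\mu$ by recoloring, where $I$ is either $G$, $H$, or $C_n$ for some $n\in\mathbb{N}$.
   Context: All graphs are finite, simple, loopless; every graph has at least two vertices and no isolated vertices. $G\times H$ is the tensor product (vertices $V(G)\times V(H)$, $(g,h)(g',h')$ an edge iff $gg'\in E(G)$ and $hh'\in E(H)$). A graph is square-free if there are no four pairwise distinct vertices $v_1,\dots,v_4$ with $v_1v_2,v_2v_3,v_3v_4,v_4v_1$ edges. $C_n$ is the graph with vertex set $\{0,\dots,n-1\}$ and edges $\{i,i+1\bmod n\}$. A $K$-coloring of a graph is a homomorphism to $K$; $\mu^*$ is reachable from $\mu$ by recoloring if there is a sequence of $K$-colorings $\mu=\mu_0,\dots,\mu_m=\mu^*$ of $G\times H$ with consecutive ones differing on at most one vertex. *)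

theory Defs
  imports "Graph_Theory.Graph_Theory"
begin

text \<open>
  \<^const>\<open>pair_graph\<close> says: finite, symmetric and loopless arc relation on a finite
  vertex set, i.e. a finite simple graph, the edge $uv$ being the two arcs $(u,v)$ and $(v,u)$.
\<close>

definition proper_graph :: "'a pair_pre_digraph \<Rightarrow> bool" where
  "proper_graph G \<longleftrightarrow> pair_graph G \<and> 2 \<le> card (pverts G) \<and>
     (\<forall>v\<in>pverts G. \<exists>w\<in>pverts G. (v, w) \<in> parcs G)"

definition bipartite :: "'a pair_pre_digraph \<Rightarrow> bool" where
  "bipartite G \<longleftrightarrow> (\<exists>A B. pverts G = A \<union> B \<and> A \<inter> B = {} \<and>
     (\<forall>(u, v)\<in>parcs G. (u \<in> A \<and> v \<in> B) \<or> (u \<in> B \<and> v \<in> A)))"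

definition square_free :: "'a pair_pre_digraph \<Rightarrow> bool" where
  "square_free G \<longleftrightarrow> \<not> (\<exists>v1 v2 v3 v4. distinct [v1, v2, v3, v4] \<and>
     (v1, v2) \<in> parcs G \<and> (v2, v3) \<in> parcs G \<and> (v3, v4) \<in> parcs G \<and> (v4, v1) \<in> parcs G)"

definition tensor_product ::
  "'a pair_pre_digraph \<Rightarrow> 'b pair_pre_digraph \<Rightarrow> ('a \<times> 'b) pair_pre_digraph"
  where
  "tensor_product G H =
     \<lparr>pverts = pverts G \<times> pverts H,
      parcs = {((g, h), (g', h')) | g h g' h'. (g, g') \<in> parcs G \<and> (h, h') \<in> parcs H}\<rparr>"

definition cycle_graph :: "nat \<Rightarrow> nat pair_pre_digraph" where
  "cycle_graph n =
     \<lparr>pverts = {0..<n},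
      parcs = (\<Union>i\<in>{0..<n}. {(i, (i + 1) mod n), ((i + 1) mod n, i)})\<rparr>"

text \<open>
  Only the values of a homomorphism on the vertices of its source matter; values elsewhere
  are unconstrained.
\<close>

definition graph_hom :: "'a pair_pre_digraph \<Rightarrow> 'b pair_pre_digraph \<Rightarrow> ('a \<Rightarrow> 'b) \<Rightarrow> bool" where
  "graph_hom G K f \<longleftrightarrow> (\<forall>v\<in>pverts G. f v \<in> pverts K) \<and>
     (\<forall>(u, v)\<in>parcs G. (f u, f v) \<in> parcs K)"

definition recoloring_reachable ::
  "'a pair_pre_digraph \<Rightarrow> 'b pair_pre_digraph \<Rightarrow> ('a \<Rightarrow> 'b) \<Rightarrow> ('a \<Rightarrow> 'b) \<Rightarrow> bool"
  where
  "recoloring_reachable G K f f' \<longleftrightarrow> (\<exists>(m::nat) s. s 0 = f \<and> s m = f' \<and>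
     (\<forall>i\<le>m. graph_hom G K (s i)) \<and>
     (\<forall>i<m. card {v \<in> pverts G. s i v \<noteq> s (Suc i) v} \<le> 1))"

definition factors_through ::
  "'a pair_pre_digraph \<Rightarrow> 'i pair_pre_digraph \<Rightarrow> 'b pair_pre_digraph \<Rightarrow> ('a \<Rightarrow> 'b) \<Rightarrow> bool"
  where
  "factors_through G I K f \<longleftrightarrow> (\<exists>\<gamma> \<delta>. graph_hom G I \<gamma> \<and> graph_hom I K \<delta> \<and>
     (\<forall>v\<in>pverts G. f v = (\<delta> \<circ> \<gamma>) v))"

lemma proper_graph_tensor_product:
  assumes "proper_graph G" "proper_graph H"
  shows "proper_graph (tensor_product G H)"
proof -
  interpret G: pair_graph G using assms by (simp add: proper_graph_def)
  interpret H: pair_graph H using assms by (simp add: proper_graph_def)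
  have sub: "parcs (tensor_product G H) \<subseteq> (pverts G \<times> pverts H) \<times> (pverts G \<times> pverts H)"
    by (auto simp: tensor_product_def dest: G.wellformed' H.wellformed')
  have "pair_graph (tensor_product G H)"
  proof
    show "finite (parcs (tensor_product G H))"
      by (rule finite_subset[OF sub]) (simp add: G.pair_finite_verts H.pair_finite_verts)
    have "sym (parcs G)" "sym (parcs H)"
      using G.pair_sym_arcs H.pair_sym_arcs by (simp_all add: symmetric_def)
    then show "symmetric (tensor_product G H)"
      by (auto simp: symmetric_def tensor_product_def sym_def)
  qed (auto simp: tensor_product_def G.pair_finite_verts H.pair_finite_verts
            dest: G.wellformed' H.wellformed' G.pair_no_loops)
  moreover have "2 \<le> card (pverts (tensor_product G H))"
  proof -
    have "2 \<le> card (pverts G)" "2 \<le> card (pverts H)"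
      using assms by (simp_all add: proper_graph_def)
    then have "2 * 1 \<le> card (pverts G) * card (pverts H)" by (intro mult_le_mono) auto
    then show ?thesis by (simp add: tensor_product_def card_cartesian_product)
  qed
  ultimately show ?thesis
    using assms by (fastforce simp: proper_graph_def tensor_product_def)
qed

lemma proper_graph_cycle_graph: "proper_graph (cycle_graph n) \<longleftrightarrow> 2 \<le> n"
proof
  assume "proper_graph (cycle_graph n)"
  then show "2 \<le> n" by (simp add: proper_graph_def cycle_graph_def)
next
  assume n: "2 \<le> n"
  have ne: "i \<noteq> Suc i mod n" if "i < n" for i
    using n that by (cases "Suc i = n") auto
  have "pair_graph (cycle_graph n)"
  proof
    show "symmetric (cycle_graph n)"
      by (auto simp: symmetric_def cycle_graph_def sym_def)
  qed (use n ne in \<open>auto simp: cycle_graph_def dest: sym\<close>)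
  then show "proper_graph (cycle_graph n)"
    using n by (fastforce simp: proper_graph_def cycle_graph_def)
qed

end

theory Submission
  imports Defs
begin

text \<open>
  The walks in \<open>G \<times> H\<close> act on the universal cover of \<open>K\<close>; since \<open>K\<close> is square-free, closed walks of
  length 4 act trivially, so closed walks of even length in \<open>G\<close> act by deck transformations that commute
  with those of closed walks of even length in \<open>H\<close>.

  If those of \<open>G\<close> act trivially, each layer \<open>G \<times> {h}\<close> lifts to the universal cover, which is a tree.
  As long as some layer is not constant, one of the layers of maximal diameter has an end point all of
  whose neighbours lie further inside; recoloring moves it inwards. When all layers are constant, the
  coloring factors through \<open>H\<close>. The case that \<open>H\<close> acts trivially is symmetric.

  Otherwise let \<open>a\<close> from \<open>G\<close> and \<open>b\<close> from \<open>H\<close> be nontrivial. The powers of \<open>a\<close> converge to an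
  end of the tree. It is fixed by everything commuting with \<open>a\<close>, in particular by \<open>b\<close>; hence also by
  everything commuting with \<open>b\<close>, and finally by every closed walk in \<open>G \<times> H\<close>, whose square is a product
  of the two kinds. So each vertex of \<open>G \<times> H\<close> sees the end as an infinite reduced walk in \<open>K\<close>, and
  for adjacent vertices one of these is the tail of the other. As \<open>G \<times> H\<close> has odd closed walks, they are all
  eventually periodic, and pushing the vertices towards the end makes them periodic, which is a
  factorization through a cycle.
\<close>

section \<open>Walks\<close>

text \<open>Even closed walks are the natural unit: while one coordinate runs through a closed walk,
  the other has to spend the same time and return, which it does by going back and forth along an
  edge. The obstacle is that closed walks of the same factor need not commute with one another, only
  those of different factors do. Commuting nontrivial elements of a free group share an axis; one
  end of it is enough here, so neither axes nor primitive roots have to be constructed. Both kinds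
  of recoloring rest on one local move: a vertex whose neighbours all have the color
  \<open>x\<close> may take any neighbour of \<open>x\<close> as its new color.\<close>

fun walk :: "('a \<times> 'a) set \<Rightarrow> 'a \<Rightarrow> 'a list \<Rightarrow> 'a \<Rightarrow> bool" where
  "walk E x [] y \<longleftrightarrow> x = y"
| "walk E x (u # us) y \<longleftrightarrow> (x, u) \<in> E \<and> walk E u us y"

lemma walk_append: "walk E x (us @ vs) z \<longleftrightarrow> (\<exists>y. walk E x us y \<and> walk E y vs z)"
  by (induction us arbitrary: x) auto

lemma walk_appendI: "walk E x us y \<Longrightarrow> walk E y vs z \<Longrightarrow> walk E x (us @ vs) z"
  by (auto simp: walk_append)

lemma walk_in: "walk E x us y \<Longrightarrow> E \<subseteq> V \<times> V \<Longrightarrow> x \<in> V \<Longrightarrow> y \<in> V"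
  by (induction us arbitrary: x) auto

text \<open>Walks are stored without their start, so that concatenation is \<open>@\<close> and the
  letters act by \<open>fold step\<close>. Reversal therefore drops the end and appends the start
  \<open>x\<close>.\<close>

fun rev_walk :: "'a \<Rightarrow> 'a list \<Rightarrow> 'a list" where
  "rev_walk x [] = []"
| "rev_walk x (u # us) = rev_walk u us @ [x]"

lemma length_rev_walk [simp]: "length (rev_walk x us) = length us"
  by (induction us arbitrary: x) auto

lemma walk_rev_walk: "sym E \<Longrightarrow> walk E x us y \<Longrightarrow> walk E y (rev_walk x us) x"
proof (induction us arbitrary: x)
  case (Cons u us)
  then show ?case using symD[of E x u] by (auto simp: walk_append)
qed simp

lemma map_rev_walk: "map f (rev_walk x us) = rev_walk (f x) (map f us)"
  by (induction us arbitrary: x) auto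

lemma rev_walk_zip:
  "length us = length vs \<Longrightarrow> rev_walk (x, y) (zip us vs) = zip (rev_walk x us) (rev_walk y vs)"
  by (induction us vs arbitrary: x y rule: list_induct2) auto

text \<open>Going back and forth along an edge, starting in \<open>b\<close>, which comes second
  because walks omit their start. This is the filler for one coordinate while the other one
  walks.\<close>

fun alternate :: "nat \<Rightarrow> 'a \<Rightarrow> 'a \<Rightarrow> 'a list" where
  "alternate 0 a b = []"
| "alternate (Suc n) a b = a # alternate n b a"

lemma length_alt [simp]: "length (alternate n a b) = n"
  by (induction n arbitrary: a b) auto

lemma alternate_append: "alternate (m + n) a b = alternate m a b @ (if even m then alternate n a b else alternate n b a)"
  by (induction m arbitrary: a b) auto

lemma walk_alt:
  assumes "sym E" "(b, a) \<in> E"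
  shows "walk E b (alternate n a b) (if even n then b else a)"
  using assms(2)
proof (induction n arbitrary: a b)
  case (Suc n)
  then show ?case using symD[OF assms(1), of b a] by auto
qed simp

section \<open>Reduced walks\<close>

text \<open>
  The universal cover of a graph, seen from a vertex \<open>x\<close>, consists of the reduced walks starting
  in \<open>x\<close>. Moving from \<open>x\<close> to a neighbour \<open>w\<close> changes the point of view by \<open>step w\<close>, while
  \<open>stepR\<close> moves the point itself. These operations are independent of each other, so a closed walk acts by deck transformations.
\<close>

definition step :: "'c \<Rightarrow> 'c list \<Rightarrow> 'c list" where
  "step w p = (if 2 \<le> length p \<and> p ! 1 = w then tl p else w # p)"

definition stepR :: "'c list \<Rightarrow> 'c \<Rightarrow> 'c list" where
  "stepR p k = (if 2 \<le> length p \<and> p ! (length p - 2) = k then butlast p else p @ [k])"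

definition reduced :: "('c \<times> 'c) set \<Rightarrow> 'c list \<Rightarrow> bool" where
  "reduced E p \<longleftrightarrow> p \<noteq> [] \<and> (\<forall>i. Suc i < length p \<longrightarrow> (p ! i, p ! Suc i) \<in> E) \<and>
     (\<forall>i. Suc (Suc i) < length p \<longrightarrow> p ! i \<noteq> p ! Suc (Suc i))"

lemma reduced_simps [simp]:
  "\<not> reduced E []" "reduced E [x]"
  "reduced E (x # y # r) \<longleftrightarrow> (x, y) \<in> E \<and> (r = [] \<or> x \<noteq> hd r) \<and> reduced E (y # r)"
proof -
  have all0: "(\<forall>i. P i) \<longleftrightarrow> P 0 \<and> (\<forall>i. P (Suc i))" for P :: "nat \<Rightarrow> bool"
    by (metis not0_implies_Suc)
  have 1: "(\<forall>i. Suc i < length (x # y # r) \<longrightarrow> ((x # y # r) ! i, (x # y # r) ! Suc i) \<in> E) \<longleftrightarrow>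
     (x, y) \<in> E \<and> (\<forall>i. Suc i < length (y # r) \<longrightarrow> ((y # r) ! i, (y # r) ! Suc i) \<in> E)"
    by (subst all0) simp
  have 2: "(\<forall>i. Suc (Suc i) < length (x # y # r) \<longrightarrow> (x # y # r) ! i \<noteq> (x # y # r) ! Suc (Suc i)) \<longleftrightarrow>
     (r = [] \<or> x \<noteq> hd r) \<and> (\<forall>i. Suc (Suc i) < length (y # r) \<longrightarrow> (y # r) ! i \<noteq> (y # r) ! Suc (Suc i))"
    by (subst all0) (cases r, simp_all)
  show "reduced E (x # y # r) \<longleftrightarrow> (x, y) \<in> E \<and> (r = [] \<or> x \<noteq> hd r) \<and> reduced E (y # r)"
    unfolding reduced_def 1 2 by auto
qed (auto simp: reduced_def)

lemma reduced_not_Nil: "reduced E p \<Longrightarrow> p \<noteq> []" by auto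

lemma step_simps [simp]:
  "step w [x] = [w, x]" "step w (x # y # r) = (if w = y then y # r else w # x # y # r)"
  by (auto simp: step_def)

lemma stepR_rev: "stepR p k = rev (step k (rev p))"
proof -
  have "tl (rev p) = rev (butlast p)"
    by (cases p rule: rev_cases) auto
  moreover have "2 \<le> length p \<Longrightarrow> rev p ! 1 = p ! (length p - 2)"
    by (simp add: rev_nth numeral_2_eq_2)
  ultimately show ?thesis by (auto simp: stepR_def step_def)
qed

text \<open>The operations edit opposite ends of the list, so they can interact only on very short
  lists, which are checked separately.\<close>

lemma stepR_step: "stepR (step w p) k = step w (stepR p k)"
proof -
  consider "p = []" | x where "p = [x]" | x y where "p = [x,y]" | x y z r where "p = x # y # r @ [z]"
    by (metis append_butlast_last_id list.exhaust)
  then show ?thesis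
  proof cases
    case 4
    have "(y # r @ [z]) ! length r = (y # r) ! length r"
      by (metis append_Cons length_Cons lessI nth_append)
    then show ?thesis using 4
      by (cases r) (auto simp: step_def stepR_def nth_append nth_Cons' butlast_append)
  qed (auto simp: step_def stepR_def)
qed

lemma act_actR: "fold step ws (foldl stepR p ks) = foldl stepR (fold step ws p) ks"
proof (induction ws arbitrary: p)
  case (Cons w ws)
  have "step w (foldl stepR p ks) = foldl stepR (step w p) ks"
    by (induction ks arbitrary: p) (auto simp: stepR_step)
  with Cons show ?case by simp
qed simp

lemma reduced_append_one: 
  assumes "reduced E (p @ [z])" "p \<noteq> []"
  shows "reduced E p"
  unfolding reduced_def
proof (intro conjI allI impI)
  fix i assume "Suc i < length p"
  moreover from this assms have "((p @ [z]) ! i, (p @ [z]) ! Suc i) \<in> E" unfolding reduced_def by auto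
  ultimately show "(p ! i, p ! Suc i) \<in> E" by (simp add: nth_append)
next
  fix i assume "Suc (Suc i) < length p"
  moreover from this assms have "(p @ [z]) ! i \<noteq> (p @ [z]) ! Suc (Suc i)" unfolding reduced_def by auto
  ultimately show "p ! i \<noteq> p ! Suc (Suc i)" by (simp add: nth_append)
qed (use assms in simp)

lemma reduced_prefix: "reduced E (p @ q) \<Longrightarrow> p \<noteq> [] \<Longrightarrow> reduced E p"
proof (induction q rule: rev_induct)
  case (snoc z q)
  then show ?case using reduced_append_one[of E "p @ q" z] by simp
qed simp

lemma foldl_stepR_append: "reduced E (q @ r) \<Longrightarrow> q \<noteq> [] \<Longrightarrow> foldl stepR q r = q @ r"
proof (induction r arbitrary: q)
  case (Cons k r)
  have r: "reduced E (q @ [k])" using Cons.prems reduced_prefix[of E "q @ [k]" r] by simp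
  have "\<not> (2 \<le> length q \<and> q ! (length q - 2) = k)"
  proof
    assume a: "2 \<le> length q \<and> q ! (length q - 2) = k"
    have "(q @ [k]) ! (length q - 2) \<noteq> (q @ [k]) ! Suc (Suc (length q - 2))"
      using r a unfolding reduced_def by auto
    moreover have "Suc (Suc (length q - 2)) = length q" using a by arith
    ultimately show False using a by (auto simp: nth_append split: if_splits)
  qed
  then have "stepR q k = q @ [k]" by (auto simp: stepR_def)
  then show ?case using Cons.IH[of "q @ [k]"] Cons.prems by simp
qed simp

lemma reduced_foldl: "reduced E p \<Longrightarrow> foldl stepR [hd p] (tl p) = p"
  using foldl_stepR_append[of E "[hd p]" "tl p"] by (cases p) auto

lemma foldl_stepR_back: "p \<noteq> [] \<Longrightarrow> foldl stepR p (tl (rev p)) = [hd p]"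
proof (induction p rule: rev_induct)
  case (snoc z p)
  show ?case
  proof (cases "p = []")
    case False
    then have t: "rev p = last p # tl (rev p)" by (cases p rule: rev_cases) auto
    have "stepR (p @ [z]) (last p) = p"
      using False by (cases p rule: rev_cases) (auto simp: stepR_def nth_append butlast_append)
    then have "foldl stepR (p @ [z]) (rev p) = foldl stepR p (tl (rev p))"
      by (subst t) simp
    with False snoc show ?thesis by simp
  qed simp
qed simp

lemma foldl_stepR_connect: "reduced E q \<Longrightarrow> p \<noteq> [] \<Longrightarrow> hd p = hd q \<Longrightarrow> foldl stepR p (tl (rev p) @ tl q) = q"
  by (simp add: foldl_stepR_back reduced_foldl)

text \<open>Every reduced walk grows out of its head by \<open>stepR\<close>, so the action is
  determined by its effect on the one-point walk.\<close>

lemma act_from_root: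
  "reduced E p \<Longrightarrow> fold step ws p = foldl stepR (fold step ws [hd p]) (tl p)"
  using act_actR[of ws "[hd p]" "tl p"] by (simp add: reduced_foldl)

text \<open>Deck transformations act freely. Retracting \<open>p\<close> by \<open>stepR\<close>
  carries the fixed point to the root; \<open>fix_all\<close> is the way back.\<close>

lemma fix_root: 
  assumes "p \<noteq> []" "fold step ws p = p"
  shows "fold step ws [hd p] = [hd p]"
  using act_actR[of ws p "tl (rev p)"] assms by (simp add: foldl_stepR_back)

lemma fix_all: "fold step ws [x] = [x] \<Longrightarrow> reduced E p \<Longrightarrow> hd p = x \<Longrightarrow> fold step ws p = p"
  using act_from_root[of E p ws] reduced_foldl[of E p] by simp

lemma last_step: "p \<noteq> [] \<Longrightarrow> last (step w p) = last p"
  by (cases p) (auto simp: step_def last_tl)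

lemma hd_step: "p \<noteq> [] \<Longrightarrow> hd (step w p) = w"
  by (cases p; cases "tl p") (auto simp: step_def)

lemma step_not_Nil [simp]: "step w p \<noteq> []"
  by (cases p) (auto simp: step_def)

lemma last_act: "p \<noteq> [] \<Longrightarrow> last (fold step ws p) = last p"
  by (induction ws arbitrary: p) (auto simp: last_step)

lemma parity_act: "p \<noteq> [] \<Longrightarrow> even (length (fold step ws p)) = even (length p + length ws)"
proof (induction ws arbitrary: p)
  case (Cons w ws)
  have "even (length (step w p)) = odd (length p)" by (auto simp: step_def)
  with Cons show ?case by auto
qed simp

lemma length_step_le: "length (step w p) \<le> Suc (length p)"
  by (auto simp: step_def)

text \<open>The action on a one-point walk yields the geodesic between the ends, so reversing the
  walk reverses the result. In the induction the first letter is supplied at the other end, by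
  \<open>stepR\<close>.\<close>

lemma act_rev_walk: "fold step (rev_walk x ws) [last (x # ws)] = rev (fold step ws [x])"
proof (induction ws arbitrary: x)
  case (Cons u ws)
  have "fold step ws [u, x] = stepR (fold step ws [u]) x"
    using act_actR[of ws "[u]" "[x]"] by (simp add: stepR_def)
  then show ?case using Cons[of u] by (simp add: stepR_rev)
qed simp

lemma walk_last: "walk E x ws y \<Longrightarrow> last (x # ws) = y"
  by (induction ws arbitrary: x) auto

locale simple_edges =
  fixes E :: "('c \<times> 'c) set"
  assumes symE: "sym E" and irr: "(x, x) \<notin> E"
begin

lemma reduced_rev: "reduced E (rev p) \<longleftrightarrow> reduced E p"
proof -
  have "reduced E (rev p)" if "reduced E p" for p
    unfolding reduced_def
  proof (intro conjI allI impI)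
    show "rev p \<noteq> []" using that by auto
  next
    fix i assume i: "Suc i < length (rev p)"
    let ?j = "length p - Suc (Suc i)"
    have "(p ! ?j, p ! Suc ?j) \<in> E" using that i unfolding reduced_def by auto
    moreover have "Suc ?j = length p - Suc i" using i by auto
    ultimately have "(p ! (length p - Suc i), p ! ?j) \<in> E" using symE by (metis symD)
    then show "(rev p ! i, rev p ! Suc i) \<in> E" using i by (simp add: rev_nth)
  next
    fix i assume i: "Suc (Suc i) < length (rev p)"
    let ?j = "length p - Suc (Suc (Suc i))"
    have "p ! ?j \<noteq> p ! Suc (Suc ?j)" using that i unfolding reduced_def by auto
    moreover have "Suc (Suc ?j) = length p - Suc i" using i by auto
    ultimately show "rev p ! i \<noteq> rev p ! Suc (Suc i)" using i by (auto simp: rev_nth)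
  qed
  from this[of p] this[of "rev p"] show ?thesis by auto
qed

lemma reduced_step: "reduced E p \<Longrightarrow> (hd p, w) \<in> E \<Longrightarrow> reduced E (step w p)"
  using symD[OF symE, of "hd p" w] by (cases p; cases "tl p") auto

lemma step_back: "reduced E p \<Longrightarrow> step (hd p) (step w p) = p"
  by (cases p; cases "tl p"; cases "tl (tl p)") auto

lemma reduced_stepR: "reduced E p \<Longrightarrow> (last p, w) \<in> E \<Longrightarrow> reduced E (stepR p w)"
  unfolding stepR_rev reduced_rev by (rule reduced_step) (auto simp: reduced_rev hd_rev)

lemma stepR_back: "reduced E p \<Longrightarrow> stepR (stepR p w) (last p) = p"
  unfolding stepR_rev using step_back[of "rev p" w] by (simp add: reduced_rev hd_rev)

lemma reduced_act: 
  "reduced E p \<Longrightarrow> walk E (hd p) ws y \<Longrightarrow> reduced E (fold step ws p) \<and> hd (fold step ws p) = y"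
  by (induction ws arbitrary: p) (auto simp: reduced_step hd_step reduced_not_Nil)

lemma last_stepR: "p \<noteq> [] \<Longrightarrow> last (stepR p w) = w"
  by (simp add: stepR_rev last_rev hd_step)

lemma reduced_actR: 
  "reduced E p \<Longrightarrow> walk E (last p) ws y \<Longrightarrow> reduced E (foldl stepR p ws) \<and> last (foldl stepR p ws) = y"
  by (induction ws arbitrary: p) (auto simp: reduced_stepR last_stepR reduced_not_Nil)

lemma act_back:
  "reduced E p \<Longrightarrow> walk E (hd p) ws y \<Longrightarrow> fold step (rev_walk (hd p) ws) (fold step ws p) = p"
proof (induction ws arbitrary: p)
  case (Cons w ws)
  then have "reduced E (step w p)" "hd (step w p) = w" by (auto simp: reduced_step hd_step reduced_not_Nil)
  with Cons.IH[of "step w p"] Cons.prems show ?case by (simp add: step_back)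
qed simp

lemma act_inj:
  assumes "reduced E p" "reduced E q" "hd p = hd q" "walk E (hd p) ws y" "fold step ws p = fold step ws q"
  shows "p = q"
  using act_back[of p ws y] act_back[of q ws y] assms by metis

lemma reduced_walk: "reduced E p \<Longrightarrow> walk E (hd p) (tl p) (last p)"
proof (induction p)
  case (Cons x p) then show ?case by (cases p) auto
qed simp

lemma reduced_join:
  assumes "reduced E q" "reduced E (last q # s)" "s = [] \<or> length q < 2 \<or> q ! (length q - 2) \<noteq> hd s"
  shows "reduced E (q @ s)"
  using assms
proof (induction q)
  case (Cons x q)
  show ?case
  proof (cases q)
    case (Cons y q')
    then show ?thesis using Cons.IH Cons.prems
      by (cases q'; cases s) (auto simp: nth_Cons')
  qed (use Cons in auto)
qed simp

text \<open>
  The fundamental group is torsion-free: a cyclically reduced word has no cancellation in its powers,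
  and any other word is conjugate to a shorter one.
\<close>

lemma power_nontrivial:
  assumes "reduced E q" "hd q = x" "last q = x" "q \<noteq> [x]" "m \<ge> 1"
  shows "foldl stepR [x] (concat (replicate m (tl q))) \<noteq> [x]"
  using assms
proof (induction "length q" arbitrary: q x rule: less_induct)
  case less
  then obtain y r where q: "q = x # y # r"
    by (cases q; cases "tl q") auto
  obtain r' where r: "r = r' @ [x]" "r' \<noteq> []"
  proof (cases r rule: rev_cases)
    case Nil
    then show ?thesis using less.prems q irr by auto
  next
    case (snoc r' z)
    then show ?thesis using less.prems q that[of r'] by (cases r') auto
  qed
  show ?case
  proof (cases "last r' = y")
    case False
    have "reduced E (x # concat (replicate m (tl q)))" for m
    proof (induction m)
      case (Suc m)
      have "q ! (length q - 2) = last r'" using q r by (cases r' rule: rev_cases) (auto simp: nth_append)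
      moreover have "concat (replicate m (tl q)) = [] \<or> hd (concat (replicate m (tl q))) = y"
        using q by (cases m) auto
      ultimately have "reduced E (q @ concat (replicate m (tl q)))"
        using less.prems Suc False q by (intro reduced_join) auto
      then show ?case using q by simp
    qed simp
    then have "foldl stepR [x] (concat (replicate m (tl q))) = x # concat (replicate m (tl q))"
      using foldl_stepR_append[of E "[x]"] by simp
    then show ?thesis using q less.prems by (cases m) auto
  next
    case True
    \<comment> \<open>\<open>q\<close> is the shorter closed walk \<open>?q\<close> at
      \<open>y\<close>, conjugated by the edge from \<open>x\<close> to \<open>y\<close>.\<close>
    let ?q = "y # r'"
    have q': "q = (x # ?q) @ [x]" using q r by simp
    have rq: "reduced E (x # ?q)" using less.prems(1) reduced_prefix[of E "x # ?q" "[x]"] q' by simp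
    then have rq': "reduced E ?q" and xy: "(x, y) \<in> E" by auto
    have nt: "foldl stepR [y] (concat (replicate m r')) \<noteq> [y]"
      using less.hyps[of ?q y] q' rq' True r less.prems(5) by simp
    let ?p = "\<lambda>m. foldl stepR [x, y] (concat (replicate m r'))"
    have w1: "walk E y r' y" using reduced_walk[OF rq'] True r by simp
    have w: "walk E y (concat (replicate m r')) y" for m
      by (induction m) (auto intro: walk_appendI[OF w1])
    have p: "reduced E (?p m) \<and> last (?p m) = y" for m
      using reduced_actR[of "[x,y]" "concat (replicate m r')" y] w xy by simp
    \<comment> \<open>Between consecutive copies of \<open>tl q\<close> the moves to
      \<open>x\<close> and back to \<open>y\<close> cancel, so only the final move to
      \<open>x\<close> remains.\<close>
    have eq: "foldl stepR [x] (concat (replicate m (tl q))) = stepR (?p m) x" for m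
    proof (induction m)
      case (Suc m)
      have "concat (replicate (Suc m) s) = concat (replicate m s) @ s" for s :: "'c list"
        by (induction m) auto
      then show ?case using Suc q r p[of m] stepR_back[of "?p m" x]
        by (simp del: replicate.simps)
    qed (simp add: stepR_def)
    show ?thesis
    proof
      assume "foldl stepR [x] (concat (replicate m (tl q))) = [x]"
      then have "?p m = stepR [x] y" using eq p[of m] stepR_back[of "?p m" x] by simp
      then have "?p m = [x, y]" by (simp add: stepR_def)
      \<comment> \<open>Stepping to \<open>y\<close> strips the conjugating edge on the left and
        leaves the power of \<open>?q\<close>, which is nontrivial by induction.\<close>
      then have "fold step [y] (?p m) = [y]" by simp
      then show False using nt act_actR[of "[y]" "[x,y]"] by simp
    qed
  qed
qed

text \<open>The iterates act on the left and commute with \<open>stepR\<close>, so each one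
  contributes the same reduced word on the right, where \<open>power_nontrivial\<close>
  applies.\<close>

lemma act_funpow:
  assumes "reduced E (fold step ws [x])" "hd (fold step ws [x]) = x"
  shows "(fold step ws ^^ m) [x] = foldl stepR [x] (concat (replicate m (tl (fold step ws [x]))))"
proof (induction m)
  case (Suc m)
  let ?q = "fold step ws [x]"
  have c: "(fold step ws ^^ m) (foldl stepR p ks) = foldl stepR ((fold step ws ^^ m) p) ks" for p ks
    by (induction m) (auto simp: act_actR)
  have "(fold step ws ^^ Suc m) [x] = (fold step ws ^^ m) (foldl stepR [x] (tl ?q))"
    using assms reduced_foldl[of E ?q] by (simp add: funpow_Suc_right del: funpow.simps)
  also have "\<dots> = foldl stepR ((fold step ws ^^ m) [x]) (tl ?q)" by (rule c)
  also have "\<dots> = foldl stepR [x] (concat (replicate m (tl ?q)) @ tl ?q)" using Suc by simp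
  also have "concat (replicate m (tl ?q)) @ tl ?q = concat (replicate (Suc m) (tl ?q))"
    by (induction m) auto
  finally show ?case .
qed simp

lemma torsion_free:
  assumes "walk E x ws x" "(fold step ws ^^ m) [x] = [x]" "m \<ge> 1"
  shows "fold step ws [x] = [x]"
proof -
  have "reduced E (fold step ws [x])" "hd (fold step ws [x]) = x" "last (fold step ws [x]) = x"
    using reduced_act[of "[x]" ws x] last_act[of "[x]" ws] assms(1) by simp_all
  with act_funpow[of ws x m] power_nontrivial[of "fold step ws [x]" x m] assms(2,3)
  show ?thesis by metis
qed

end

section \<open>Homotopies of walks\<close>

text \<open>
  A square-free graph has only degenerate closed walks of length 4, so isolated changes do not affect
  the action of a walk as long as its end is kept.
\<close>

inductive isolated_diff :: "'a list \<Rightarrow> 'a list \<Rightarrow> bool" where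
  isolated_diff_Nil: "isolated_diff [] []"
| isolated_diff_same: "isolated_diff us vs \<Longrightarrow> isolated_diff (u # us) (u # vs)"
| isolated_diff_diff: "isolated_diff us vs \<Longrightarrow> isolated_diff (a # c # us) (b # c # vs)"

lemma isolated_diff_refl: "isolated_diff us us"
  by (induction us) (auto intro: isolated_diff.intros)

lemma isolated_diff_length: "isolated_diff us vs \<Longrightarrow> length us = length vs"
  by (induction rule: isolated_diff.induct) auto

lemma isolated_diff_zip_left:
  "isolated_diff us us' \<Longrightarrow> length us = length vs \<Longrightarrow> isolated_diff (map f (zip us vs)) (map f (zip us' vs))"
proof (induction arbitrary: vs rule: isolated_diff.induct)
  case (isolated_diff_same us us' u)
  then show ?case by (cases vs) (auto intro: isolated_diff.intros)
next
  case (isolated_diff_diff us us' a c b)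
  then obtain v1 v2 vs' where "vs = v1 # v2 # vs'" by (cases vs; cases "tl vs") auto
  with isolated_diff_diff show ?case by (auto intro: isolated_diff.intros)
qed (auto intro: isolated_diff.intros)

lemma isolated_diff_zip_right:
  "isolated_diff vs vs' \<Longrightarrow> length us = length vs \<Longrightarrow> isolated_diff (map f (zip us vs)) (map f (zip us vs'))"
proof (induction arbitrary: us rule: isolated_diff.induct)
  case (isolated_diff_same vs vs' v)
  then show ?case by (cases us) (auto intro: isolated_diff.intros)
next
  case (isolated_diff_diff vs vs' a c b)
  then obtain v1 v2 us' where "us = v1 # v2 # us'" by (cases us; cases "tl us") auto
  with isolated_diff_diff show ?case by (auto intro: isolated_diff.intros)
qed (auto intro: isolated_diff.intros)

definition flips :: "('a \<times> 'a) set \<Rightarrow> 'a \<Rightarrow> 'a \<Rightarrow> ('a list \<times> 'a list) set" where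
  "flips E x y = {(us, us'). walk E x us y \<and> walk E x us' y \<and> isolated_diff us us'}\<^sup>*"

lemma flips_refl: "(us, us) \<in> flips E x y"
  by (simp add: flips_def)

lemma flips_trans: "(us, vs) \<in> flips E x y \<Longrightarrow> (vs, ws) \<in> flips E x y \<Longrightarrow> (us, ws) \<in> flips E x y"
  by (simp add: flips_def)

lemma flips_isodiff: "walk E x us y \<Longrightarrow> walk E x us' y \<Longrightarrow> isolated_diff us us' \<Longrightarrow> (us, us') \<in> flips E x y"
  by (auto simp: flips_def)

lemma flips_Cons:
  assumes "(us, us') \<in> flips E r y" "(x, r) \<in> E"
  shows "(r # us, r # us') \<in> flips E x y"
  using assms(1) unfolding flips_def
proof (induction rule: rtrancl_induct)
  case (step vs ws)
  then show ?case using assms(2)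
    by (intro rtrancl_into_rtrancl[OF step.IH]) (auto intro: isolated_diff_same)
qed simp

lemma isolated_diff_append: "isolated_diff us us' \<Longrightarrow> isolated_diff (us @ vs) (us' @ vs)"
  by (induction rule: isolated_diff.induct) (auto intro: isolated_diff.intros isolated_diff_refl)

lemma flips_append:
  assumes "(us, us') \<in> flips E x y" "walk E y vs z"
  shows "(us @ vs, us' @ vs) \<in> flips E x z"
  using assms(1) unfolding flips_def
proof (induction rule: rtrancl_induct)
  case (step us us')
  then show ?case using assms(2)
    by (intro rtrancl_into_rtrancl[OF step.IH]) (auto intro: walk_appendI isolated_diff_append)
qed simp

lemma flips_length: "(us, us') \<in> flips E x y \<Longrightarrow> length us = length us'"
  unfolding flips_def by (induction rule: rtrancl_induct) (auto dest: isolated_diff_length)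

lemma isolated_diff_alt: "isolated_diff (alternate (2 * k) a x) (alternate (2 * k) b x)"
  by (induction k) (auto intro: isolated_diff.intros)

lemma flips_alt:
  assumes "sym E" "(x, a) \<in> E" "(x, b) \<in> E"
  shows "(alternate (2 * k) a x, alternate (2 * k) b x) \<in> flips E x x"
  using walk_alt[OF assms(1,2), of "2 * k"] walk_alt[OF assms(1,3), of "2 * k"]
  by (intro flips_isodiff isolated_diff_alt) auto

text \<open>
  A backtrack can be moved along a walk without changing its length, so the change can be made in
  one factor of a product while the walk in the other factor stays fixed.
\<close>

lemma flips_shift:
  assumes "sym E" "walk E p us y" "(p, q) \<in> E" "(y, s) \<in> E"
  shows "(q # p # us, us @ [s, y]) \<in> flips E p y"
  using assms(2,3)
proof (induction us arbitrary: p q)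
  case Nil
  then show ?case using assms(1,4) by (auto intro!: flips_isodiff isolated_diff.intros dest: symD)
next
  case (Cons r us)
  then have pr: "(p, r) \<in> E" "(r, p) \<in> E" "(q, p) \<in> E" and w: "walk E r us y"
    using assms(1) by (auto dest: symD)
  have "(q # p # r # us, r # p # r # us) \<in> flips E p y"
    using pr w Cons.prems by (intro flips_isodiff isolated_diff.intros isolated_diff_refl) auto
  moreover have "(r # p # r # us, r # us @ [s, y]) \<in> flips E p y"
    using Cons.IH[OF w pr(2)] pr(1) by (rule flips_Cons)
  ultimately show ?case by (auto intro: flips_trans)
qed

lemma flips_shift_alt:
  assumes "sym E" "walk E p us y" "(p, q) \<in> E" "(y, s) \<in> E"
  shows "(alternate (2 * k) q p @ us, us @ alternate (2 * k) s y) \<in> flips E p y"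
proof (induction k)
  case (Suc k)
  have qp: "(q, p) \<in> E" using assms(1,3) by (auto dest: symD)
  have "(q # p # (alternate (2 * k) q p @ us), q # p # (us @ alternate (2 * k) s y)) \<in> flips E p y"
    by (intro flips_Cons Suc qp assms)
  moreover have "((q # p # us) @ alternate (2 * k) s y, (us @ [s, y]) @ alternate (2 * k) s y) \<in> flips E p y"
    using walk_alt[OF assms(1,4), of "2 * k"] by (intro flips_append[OF flips_shift[OF assms]]) auto
  ultimately show ?case by (auto intro: flips_trans)
qed (simp add: flips_refl)

text \<open>The walk is folded up from its turning point: the inner part becomes an alternation at
  \<open>u\<close>, the outer letters turn it into one at \<open>x\<close>, and finally
  \<open>u\<close> is traded for \<open>b\<close>. Thus a conjugated filler is again a filler, which
  permits a change of base point.\<close>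

lemma flips_fold:
  assumes "sym E" "walk E x us y" "(y, a) \<in> E" "(x, b) \<in> E"
  shows "(us @ alternate (2 * k) a y @ rev_walk x us, alternate (2 * (k + length us)) b x) \<in> flips E x x"
  using assms(2,4)
proof (induction us arbitrary: x b)
  case Nil
  then show ?case using assms(1,3) flips_alt by auto
next
  case (Cons u us)
  then have xu: "(x, u) \<in> E" "(u, x) \<in> E" and w: "walk E u us y" using assms(1) by (auto dest: symD)
  let ?m = "k + length us"
  have "((us @ alternate (2 * k) a y @ rev_walk u us) @ [x], alternate (2 * ?m) x u @ [x]) \<in> flips E u x"
    using Cons.IH[OF w xu(2)] xu by (intro flips_append) auto
  then have "(u # (us @ alternate (2 * k) a y @ rev_walk u us) @ [x], u # alternate (2 * ?m) x u @ [x]) \<in> flips E x x"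
    using xu(1) by (rule flips_Cons)
  moreover have "u # alternate (2 * m) x u @ [x] = alternate (2 * Suc m) u x" for m
    by (induction m) (auto simp: numeral_2_eq_2)
  ultimately have "(u # (us @ alternate (2 * k) a y @ rev_walk u us) @ [x], alternate (2 * Suc ?m) u x) \<in> flips E x x"
    by metis
  moreover have "(alternate (2 * Suc ?m) u x, alternate (2 * Suc ?m) b x) \<in> flips E x x"
    using flips_alt[OF assms(1) xu(1) Cons.prems(2)] .
  ultimately have "(u # (us @ alternate (2 * k) a y @ rev_walk u us) @ [x], alternate (2 * Suc ?m) b x) \<in> flips E x x"
    by (rule flips_trans)
  then show ?case by simp
qed

section \<open>Walks in products and their action\<close>

definition prod_edges :: "('a \<times> 'a) set \<Rightarrow> ('b \<times> 'b) set \<Rightarrow> (('a \<times> 'b) \<times> ('a \<times> 'b)) set" where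
  "prod_edges A B = {((g, h), (g', h')) | g h g' h'. (g, g') \<in> A \<and> (h, h') \<in> B}"

lemma prod_edges_iff [simp]: "((g, h), (g', h')) \<in> prod_edges A B \<longleftrightarrow> (g, g') \<in> A \<and> (h, h') \<in> B"
  by (auto simp: prod_edges_def)

lemma walk_zip:
  "length us = length vs \<Longrightarrow>
   walk (prod_edges A B) (g, h) (zip us vs) (g', h') \<longleftrightarrow> walk A g us g' \<and> walk B h vs h'"
  by (induction us vs arbitrary: g h rule: list_induct2) auto

lemma walk_prod_split:
  "walk (prod_edges A B) v W w \<Longrightarrow> walk A (fst v) (map fst W) (fst w) \<and> walk B (snd v) (map snd W) (snd w)"
  by (induction W arbitrary: v) (auto simp: prod_edges_def)

lemma walk_map:
  assumes "walk P v W w" "\<And>u v. (u, v) \<in> P \<Longrightarrow> (f u, f v) \<in> E"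
  shows "walk E (f v) (map f W) (f w)"
  using assms(1) by (induction W arbitrary: v) (auto intro: assms(2))

locale square_free_edges = simple_edges E for E :: "('c \<times> 'c) set" +
  assumes no_square: "(a, b) \<in> E \<Longrightarrow> (b, c) \<in> E \<Longrightarrow> (c, d) \<in> E \<Longrightarrow> (d, a) \<in> E \<Longrightarrow> a = c \<or> b = d"
begin

lemma isolated_diff_act:
  assumes "isolated_diff ws ws'" "walk E (hd p) ws y" "walk E (hd p) ws' y" "reduced E p"
  shows "fold step ws p = fold step ws' p"
  using assms
proof (induction arbitrary: p rule: isolated_diff.induct)
  case (isolated_diff_same us vs u)
  then have "reduced E (step u p)" "hd (step u p) = u" by (auto simp: reduced_step hd_step reduced_not_Nil)
  with isolated_diff_same show ?case by auto
next
  case (isolated_diff_diff us vs a c b)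
  then have r: "reduced E (step a p)" "hd (step a p) = a" "reduced E (step b p)" "hd (step b p) = b"
    by (auto simp: reduced_step hd_step reduced_not_Nil)
  then have r2: "reduced E (step c (step a p))" "hd (step c (step a p)) = c"
    using isolated_diff_diff.prems by (auto simp: reduced_step hd_step reduced_not_Nil)
  \<comment> \<open>\<open>hd p\<close>, \<open>a\<close>, \<open>c\<close>, \<open>b\<close> is a
    closed walk of length 4. If \<open>hd p = c\<close>, both variants go out and back and therefore
    cancel.\<close>
  have "hd p = c \<or> a = b"
    using isolated_diff_diff.prems no_square[of "hd p" a c b] symE by (auto dest: symD)
  then have "step c (step a p) = step c (step b p)"
    using step_back[OF isolated_diff_diff.prems(3)] by metis
  then show ?case using isolated_diff_diff.IH[of "step c (step a p)"] r2 isolated_diff_diff.prems by auto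
qed simp

lemma flips_act_left:
  assumes "(us, us') \<in> flips A g g'" "walk B h vs h'" "length us = length vs"
    and hom: "\<And>u v. (u, v) \<in> prod_edges A B \<Longrightarrow> (f u, f v) \<in> E"
    and p: "reduced E p" "hd p = f (g, h)"
  shows "fold step (map f (zip us vs)) p = fold step (map f (zip us' vs)) p"
  using assms(1) unfolding flips_def
proof (induction rule: rtrancl_induct)
  case (step ws ws')
  have l: "length ws = length vs" "length ws' = length vs"
    using flips_length[of us ws A g g'] step assms(3) isolated_diff_length[of ws ws'] by (auto simp: flips_def)
  have "walk E (f (g, h)) (map f (zip ws vs)) (f (g', h'))" "walk E (f (g, h)) (map f (zip ws' vs)) (f (g', h'))"
    using step.hyps(2) assms(2) l by (auto intro!: walk_map[OF _ hom] simp: walk_zip)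
  then have "fold step (map f (zip ws vs)) p = fold step (map f (zip ws' vs)) p"
    using step.hyps(2) l p by (intro isolated_diff_act[OF isolated_diff_zip_left]) auto
  with step.IH show ?case by simp
qed simp

lemma flips_act_right:
  assumes "(vs, vs') \<in> flips B h h'" "walk A g us g'" "length us = length vs"
    and hom: "\<And>u v. (u, v) \<in> prod_edges A B \<Longrightarrow> (f u, f v) \<in> E"
    and p: "reduced E p" "hd p = f (g, h)"
  shows "fold step (map f (zip us vs)) p = fold step (map f (zip us vs')) p"
  using assms(1) unfolding flips_def
proof (induction rule: rtrancl_induct)
  case (step ws ws')
  have l: "length ws = length us" "length ws' = length us"
    using flips_length[of vs ws B h h'] step assms(3) isolated_diff_length[of ws ws'] by (auto simp: flips_def)
  have "walk E (f (g, h)) (map f (zip us ws)) (f (g', h'))" "walk E (f (g, h)) (map f (zip us ws')) (f (g', h'))"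
    using step.hyps(2) assms(2) l by (auto intro!: walk_map[OF _ hom] simp: walk_zip)
  then have "fold step (map f (zip us ws)) p = fold step (map f (zip us ws')) p"
    using step.hyps(2) l p by (intro isolated_diff_act[OF isolated_diff_zip_right]) auto
  with step.IH show ?case by simp
qed simp

end

section \<open>Ends of the universal cover\<close>

text \<open>
  Infinite reduced walks are the ends of the universal cover; \<open>stepi\<close> extends \<open>step\<close> to them.
\<close>

definition stepi :: "'c \<Rightarrow> (nat \<Rightarrow> 'c) \<Rightarrow> nat \<Rightarrow> 'c" where
  "stepi w e = (if e 1 = w then (\<lambda>i. e (Suc i)) else case_nat w e)"

definition stream_prefix :: "(nat \<Rightarrow> 'c) \<Rightarrow> nat \<Rightarrow> 'c list" where
  "stream_prefix e n = map e [0..<n]"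

lemma length_pre [simp]: "length (stream_prefix e n) = n" by (simp add: stream_prefix_def)
lemma nth_pre [simp]: "i < n \<Longrightarrow> stream_prefix e n ! i = e i" by (simp add: stream_prefix_def)
lemma take_pre: "m \<le> n \<Longrightarrow> take m (stream_prefix e n) = stream_prefix e m" by (simp add: stream_prefix_def take_map)
lemma stream_prefix_Suc: "stream_prefix e (Suc n) = stream_prefix e n @ [e n]" by (simp add: stream_prefix_def)
lemma hd_pre: "n > 0 \<Longrightarrow> hd (stream_prefix e n) = e 0" by (simp add: stream_prefix_def hd_map)

lemma stream_prefix_eqI: "length p = n \<Longrightarrow> (\<And>i. i < n \<Longrightarrow> p ! i = e i) \<Longrightarrow> p = stream_prefix e n"
  by (simp add: list_eq_iff_nth_eq)

lemma step_pre:
  assumes "n \<ge> 2"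
  shows "step w (stream_prefix e n) = stream_prefix (stepi w e) (if e 1 = w then n - 1 else Suc n)"
proof (cases "e 1 = w")
  case True
  then have "step w (stream_prefix e n) = tl (stream_prefix e n)" using assms by (simp add: step_def)
  also have "\<dots> = stream_prefix (stepi w e) (n - 1)"
    using True assms by (intro stream_prefix_eqI) (auto simp: nth_tl stepi_def)
  finally show ?thesis using True by simp
next
  case False
  then have "step w (stream_prefix e n) = w # stream_prefix e n" using assms by (simp add: step_def)
  also have "\<dots> = stream_prefix (stepi w e) (Suc n)"
    using False by (intro stream_prefix_eqI) (auto simp: stepi_def nth_Cons split: nat.splits)
  finally show ?thesis using False by simp
qed

text \<open>This is the usual topology on a tree together with its ends.\<close>

definition converges :: "(nat \<Rightarrow> 'c list) \<Rightarrow> (nat \<Rightarrow> 'c) \<Rightarrow> bool" where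
  "converges s e \<longleftrightarrow> (\<forall>n. \<exists>k0. \<forall>k\<ge>k0. n \<le> length (s k) \<and> take n (s k) = stream_prefix e n)"

lemma converges_unique: 
  assumes "converges s e" "converges s e'"
  shows "e = e'"
proof
  fix i
  obtain k0 where k0: "\<forall>k\<ge>k0. Suc i \<le> length (s k) \<and> take (Suc i) (s k) = stream_prefix e (Suc i)"
    using assms(1) unfolding converges_def by blast
  obtain k1 where k1: "\<forall>k\<ge>k1. Suc i \<le> length (s k) \<and> take (Suc i) (s k) = stream_prefix e' (Suc i)"
    using assms(2) unfolding converges_def by blast
  have "stream_prefix e (Suc i) = stream_prefix e' (Suc i)" using k0 k1 by (metis max.cobounded1 max.cobounded2)
  then show "e i = e' i" by (simp add: stream_prefix_Suc)
qed

text \<open>\<open>stepR\<close> edits only the far end of a walk; hence sequences at bounded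
  distance have the same limit.\<close>

lemma converges_stepR:
  assumes "converges s e"
  shows "converges (\<lambda>k. stepR (s k) c) e"
  unfolding converges_def
proof
  fix n
  obtain k0 where k0: "\<forall>k\<ge>k0. Suc n \<le> length (s k) \<and> take (Suc n) (s k) = stream_prefix e (Suc n)"
    using assms unfolding converges_def by blast
  have "n \<le> length (stepR (s k) c) \<and> take n (stepR (s k) c) = stream_prefix e n" if "k \<ge> k0" for k
  proof -
    have l: "n < length (s k)" and t: "take (Suc n) (s k) = stream_prefix e (Suc n)" using k0 that by auto
    have "take n (stepR (s k) c) = take n (take (Suc n) (s k))"
      using l by (simp add: stepR_def take_butlast)
    then show ?thesis using k0 that by (auto simp: stepR_def take_pre)
  qed
  then show "\<exists>k0. \<forall>k\<ge>k0. n \<le> length (stepR (s k) c) \<and> take n (stepR (s k) c) = stream_prefix e n" by blast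
qed

lemma converges_foldl: "converges s e \<Longrightarrow> converges (\<lambda>k. foldl stepR (s k) r) e"
  by (induction r arbitrary: s) (auto dest: converges_stepR)

lemma converges_step:
  assumes "converges s e"
  shows "converges (\<lambda>k. step w (s k)) (stepi w e)"
  unfolding converges_def
proof
  fix n
  \<comment> \<open>Two spare entries: \<open>step\<close> inspects the second entry and may drop
    the first.\<close>
  obtain k0 where k0: "\<forall>k\<ge>k0. n + 2 \<le> length (s k) \<and> take (n + 2) (s k) = stream_prefix e (n + 2)"
    using assms unfolding converges_def by blast
  have "n \<le> length (step w (s k)) \<and> take n (step w (s k)) = stream_prefix (stepi w e) n" if k: "k \<ge> k0" for k
  proof -
    let ?t = "drop (n + 2) (s k)"
    have s: "s k = stream_prefix e (n + 2) @ ?t" using k0 k by (metis append_take_drop_id)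
    have "step w (stream_prefix e (n + 2) @ ?t) = step w (stream_prefix e (n + 2)) @ ?t"
      by (subst (1 2) step_def) (auto simp: nth_append length_0_conv[symmetric] tl_append2 simp del: length_0_conv)
    then have "step w (s k) = stream_prefix (stepi w e) (if e 1 = w then n + 2 - 1 else Suc (n + 2)) @ ?t"
      using s step_pre[of "n + 2" w e] by simp
    then show ?thesis by (auto simp: take_pre)
  qed
  then show "\<exists>k0. \<forall>k\<ge>k0. n \<le> length (step w (s k)) \<and> take n (step w (s k)) = stream_prefix (stepi w e) n" by blast
qed

lemma converges_fold: "converges s e \<Longrightarrow> converges (\<lambda>k. fold step ws (s k)) (fold stepi ws e)"
  by (induction ws arbitrary: s e) (auto dest: converges_step)

lemma converges_pre: 
  assumes "\<And>k. k \<le> f k"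
  shows "converges (\<lambda>k. stream_prefix e (f k)) e"
  unfolding converges_def
proof
  fix n
  have "\<forall>k\<ge>n. n \<le> length (stream_prefix e (f k)) \<and> take n (stream_prefix e (f k)) = stream_prefix e n"
    using assms le_trans[of n _ "f _"] by (metis length_pre take_pre)
  then show "\<exists>k0. \<forall>k\<ge>k0. n \<le> length (stream_prefix e (f k)) \<and> take n (stream_prefix e (f k)) = stream_prefix e n" by blast
qed

text \<open>A walk shorter than \<open>n\<close> edits the stream only within its first
  \<open>n\<close> entries, so a prefix goes to a prefix and the rest is merely shifted. If the end
  is fixed, the difference of \<open>n'\<close> and \<open>n\<close> is the translation length along
  it.\<close>

lemma act_pre:
  "n > length ws \<Longrightarrow> \<exists>n'>0. fold step ws (stream_prefix e n) = stream_prefix (fold stepi ws e) n' \<and>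
     (\<forall>i. fold stepi ws e (n' + i) = e (n + i))"
proof (induction ws arbitrary: e n)
  case (Cons w ws)
  let ?n = "if e 1 = w then n - 1 else Suc n"
  have "?n > length ws" using Cons.prems by auto
  from Cons.IH[OF this, of "stepi w e"] obtain n' where n': "n' > 0"
    "fold step ws (stream_prefix (stepi w e) ?n) = stream_prefix (fold stepi ws (stepi w e)) n'"
    "\<forall>i. fold stepi ws (stepi w e) (n' + i) = stepi w e (?n + i)" by blast
  have "stepi w e (?n + i) = e (n + i)" for i using Cons.prems by (auto simp: stepi_def)
  with n' step_pre[of n w e] Cons.prems show ?case by auto
qed auto

definition reduced_stream :: "('c \<times> 'c) set \<Rightarrow> (nat \<Rightarrow> 'c) \<Rightarrow> bool" where
  "reduced_stream E e \<longleftrightarrow> (\<forall>i. (e i, e (Suc i)) \<in> E \<and> e i \<noteq> e (Suc (Suc i)))"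

lemma reduced_stream_red: "reduced_stream E e \<Longrightarrow> n > 0 \<Longrightarrow> reduced E (stream_prefix e n)"
  by (auto simp: reduced_def reduced_stream_def simp flip: length_greater_0_conv)

lemma converges_redi:
  assumes "converges s e" "\<And>k. reduced E (s k)"
  shows "reduced_stream E e"
  unfolding reduced_stream_def
proof
  fix i
  obtain k0 where k0: "\<forall>k\<ge>k0. i + 3 \<le> length (s k) \<and> take (i + 3) (s k) = stream_prefix e (i + 3)"
    using assms unfolding converges_def by blast
  have "stream_prefix e (i + 3) \<noteq> []" by (simp flip: length_greater_0_conv)
  then have "reduced E (stream_prefix e (i + 3))" using k0 assms(2)[of k0] reduced_prefix[of E "take (i + 3) (s k0)" "drop (i+3) (s k0)"]
    by (metis append_take_drop_id order_refl)
  then have "Suc i < length (stream_prefix e (i + 3)) \<longrightarrow> (stream_prefix e (i + 3) ! i, stream_prefix e (i + 3) ! Suc i) \<in> E"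
    "Suc (Suc i) < length (stream_prefix e (i + 3)) \<longrightarrow> stream_prefix e (i + 3) ! i \<noteq> stream_prefix e (i + 3) ! Suc (Suc i)"
    unfolding reduced_def by blast+
  then show "(e i, e (Suc i)) \<in> E \<and> e i \<noteq> e (Suc (Suc i))" by simp
qed

lemma stepi_0: "stepi w e 0 = w"
  by (simp add: stepi_def)

context simple_edges
begin

lemma reduced_stream_stepi: "reduced_stream E e \<Longrightarrow> (e 0, w) \<in> E \<Longrightarrow> reduced_stream E (stepi w e)"
  using symD[OF symE, of "e 0" w] by (auto simp: reduced_stream_def stepi_def split: nat.splits)

lemma stepi_back: "reduced_stream E e \<Longrightarrow> stepi (e 0) (stepi w e) = e"
  unfolding reduced_stream_def stepi_def 
  by (auto simp: fun_eq_iff split: nat.splits) metis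

lemma reduced_stream_acti: 
  "reduced_stream E e \<Longrightarrow> walk E (e 0) ws y \<Longrightarrow> reduced_stream E (fold stepi ws e) \<and> fold stepi ws e 0 = y"
  by (induction ws arbitrary: e) (auto simp: reduced_stream_stepi stepi_0)

lemma acti_back:
  "reduced_stream E e \<Longrightarrow> walk E (e 0) ws y \<Longrightarrow> fold stepi (rev_walk (e 0) ws) (fold stepi ws e) = e"
proof (induction ws arbitrary: e)
  case (Cons w ws)
  then have "reduced_stream E (stepi w e)" "stepi w e 0 = w" by (auto simp: reduced_stream_stepi stepi_0)
  with Cons.IH[of "stepi w e"] Cons.prems show ?case by (simp add: stepi_back)
qed simp

text \<open>A stream is the limit of its prefixes, and the action is continuous.\<close>

lemma acti_cong:
  assumes "reduced_stream E e" "\<And>p. reduced E p \<Longrightarrow> hd p = e 0 \<Longrightarrow> fold step ws p = fold step ws' p"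
  shows "fold stepi ws e = fold stepi ws' e"
proof (rule converges_unique)
  have c: "converges (\<lambda>k. stream_prefix e (Suc k)) e" by (rule converges_pre) simp
  show "converges (\<lambda>k. fold step ws (stream_prefix e (Suc k))) (fold stepi ws e)" by (rule converges_fold[OF c])
  have "fold step ws (stream_prefix e (Suc k)) = fold step ws' (stream_prefix e (Suc k))" for k
    using assms reduced_stream_red[of E e "Suc k"] by (auto simp: hd_pre)
  then show "converges (\<lambda>k. fold step ws (stream_prefix e (Suc k))) (fold stepi ws' e)"
    using converges_fold[OF c, of ws'] by simp
qed

end

lemma take_foldl_stepR:
  "n + length r \<le> length p \<Longrightarrow> take n (foldl stepR p r) = take n p"
proof (induction r arbitrary: p)
  case (Cons k r)
  have l: "length p - 1 \<le> length (stepR p k)" by (auto simp: stepR_def)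
  then have "take n (foldl stepR (stepR p k) r) = take n (stepR p k)"
    using Cons.prems by (intro Cons.IH) auto
  also have "\<dots> = take n p" using Cons.prems by (auto simp: stepR_def take_butlast)
  finally show ?case by simp
qed simp

context simple_edges
begin

lemma act_funpow_red:
  assumes "walk E x ws x" "reduced E p" "hd p = x"
  shows "reduced E ((fold step ws ^^ k) p) \<and> hd ((fold step ws ^^ k) p) = x"
proof (induction k)
  case (Suc k)
  then show ?case using reduced_act[of "(fold step ws ^^ k) p" ws x] assms(1) by simp
qed (use assms in simp)

lemma act_funpow_inj:
  assumes "walk E x ws x" "reduced E p" "hd p = x" "reduced E q" "hd q = x"
    "(fold step ws ^^ k) p = (fold step ws ^^ k) q"
  shows "p = q"
  using assms(6)
proof (induction k)
  case (Suc k)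
  have "(fold step ws ^^ k) p = (fold step ws ^^ k) q"
    by (rule act_inj[of _ _ ws x])
      (use Suc.prems act_funpow_red[OF assms(1-3), of k] act_funpow_red[OF assms(1,4,5), of k] assms(1)
        in \<open>auto\<close>)
  with Suc.IH show ?case by simp
qed simp

lemma set_red: "reduced E p \<Longrightarrow> set p \<subseteq> insert (hd p) (Range E)"
proof (induction p)
  case (Cons x p)
  then show ?case by (cases p) auto
qed simp

text \<open>
  The powers are pairwise distinct by torsion-freeness, so their lengths tend to infinity,
  while consecutive ones have bounded distance.
\<close>

lemma power_limit:
  assumes "finite E" "walk E x ws x" "fold step ws [x] \<noteq> [x]"
  shows "\<exists>e. converges (\<lambda>k. (fold step ws ^^ k) [x]) e"
proof -
  define p where "p k = (fold step ws ^^ k) [x]" for k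
  have pr: "reduced E (p k)" "hd (p k) = x" for k
    using act_funpow_red[OF assms(2), of "[x]" k] by (auto simp: p_def)
  have inj: "inj p"
  proof (rule linorder_injI)
    fix i j :: nat assume "i < j"
    show "p i \<noteq> p j"
    proof
      assume "p i = p j"
      then have "(fold step ws ^^ i) [x] = (fold step ws ^^ i) (p (j - i))"
        using \<open>i < j\<close> by (simp add: p_def flip: funpow_add comp_apply[of "_ ^^ _" "_ ^^ _"])
      from act_funpow_inj[OF assms(2) _ _ pr this] have "p (j - i) = [x]" by simp
      then show False
        using torsion_free[OF assms(2), of "j - i"] assms(3) \<open>i < j\<close> unfolding p_def by linarith
    qed
  qed
  have long: "\<exists>k0. \<forall>k\<ge>k0. N \<le> length (p k)" for N
  proof -
    \<comment> \<open>There are only finitely many reduced walks of bounded length from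
      \<open>x\<close>, and by injectivity each is at most one power.\<close>
    have "finite {xs. set xs \<subseteq> insert x (Range E) \<and> length xs \<le> N}"
      using assms(1) by (intro finite_lists_length_le) (auto simp: finite_Range)
    then have "finite (p -` {xs. set xs \<subseteq> insert x (Range E) \<and> length xs \<le> N})"
      using inj by (rule finite_vimageI)
    moreover have "p -` {xs. set xs \<subseteq> insert x (Range E) \<and> length xs \<le> N} = {k. length (p k) \<le> N}"
      using set_red[OF pr(1)] pr(2) by auto
    ultimately have "finite {k. length (p k) \<le> N}" by simp
    then obtain m where m: "\<forall>k\<in>{k. length (p k) \<le> N}. k < m"
      by (auto simp only: finite_nat_set_iff_bounded)
    have "N \<le> length (p k)" if "k \<ge> m" for k
      using m that by (cases "length (p k) \<le> N") auto
    then show ?thesis by blast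
  qed
  \<comment> \<open>The next power always arises by the same word \<open>r\<close> on the right.
    Once the lengths exceed \<open>n + length r\<close>, the first \<open>n\<close> entries are out
    of its reach.\<close>
  define r where "r = tl (fold step ws [x])"
  have suc: "p (Suc k) = foldl stepR (p k) r" for k
  proof -
    have "p (Suc k) = (fold step ws ^^ k) (p 1)"
      by (simp add: p_def funpow_Suc_right del: funpow.simps)
    also have "p 1 = foldl stepR [x] r" using reduced_foldl[OF pr(1)[of 1]] pr(2)[of 1] by (simp add: p_def r_def)
    also have "(fold step ws ^^ k) (foldl stepR [x] r) = foldl stepR ((fold step ws ^^ k) [x]) r"
      by (induction k) (auto simp: act_actR)
    finally show ?thesis by (simp add: p_def)
  qed
  have stab: "\<exists>k0. \<forall>k\<ge>k0. n \<le> length (p k) \<and> take n (p k) = take n (p k0)" for n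
  proof -
    obtain k0 where k0: "\<forall>k\<ge>k0. n + length r \<le> length (p k)" using long by blast
    have eq: "take n (p k) = take n (p k0)" if "k \<ge> k0" for k
      using that
    proof (induction k rule: dec_induct)
      case (step k)
      then show ?case using k0 suc[of k] take_foldl_stepR[of n r "p k"] by simp
    qed simp
    have "n \<le> length (p k)" if "k \<ge> k0" for k using k0 that by (meson add_leD1)
    with eq show ?thesis by blast
  qed
  then have "\<forall>n. \<exists>k0. \<forall>k\<ge>k0. n \<le> length (p k) \<and> take n (p k) = take n (p k0)" by blast
  then obtain K where K: "\<And>n k. k \<ge> K n \<Longrightarrow> n \<le> length (p k) \<and> take n (p k) = take n (p (K n))"
    using choice[of "\<lambda>n k0. \<forall>k\<ge>k0. n \<le> length (p k) \<and> take n (p k) = take n (p k0)"] by blast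
  define e where "e i = p (K (Suc i)) ! i" for i
  have ei: "p k ! i = e i" if "k \<ge> K (Suc i)" for k i
    using K[OF that] by (metis e_def lessI nth_take)
  \<comment> \<open>\<open>K\<close> need not be monotone, and entry \<open>i\<close> is settled
    only from \<open>K (Suc i)\<close> on; hence the maximum.\<close>
  have "n \<le> length (p k) \<and> take n (p k) = stream_prefix e n" if k: "k \<ge> Max (K ` {..n})" for n k
  proof -
    have "k \<ge> K i" if "i \<le> n" for i
    proof -
      have "K i \<le> Max (K ` {..n})" using that by (intro Max_ge) auto
      then show ?thesis using k by (rule le_trans)
    qed
    moreover from this have "n \<le> length (p k)" using K by blast
    ultimately show ?thesis by (auto intro!: stream_prefix_eqI ei)
  qed
  then have "converges p e" unfolding converges_def by blast
  then show ?thesis by (auto simp: p_def[abs_def])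
qed

text \<open>The word \<open>r\<close> leads from \<open>s 0\<close> through its head to the image of
  \<open>s 0\<close>. Since \<open>c\<close> commutes with \<open>stepR\<close>, the same word leads
  from \<open>s k\<close> to its image for every \<open>k\<close>. So the sequence and its image
  stay at bounded distance and have the same limit.\<close>

lemma push_limit:
  assumes c: "\<And>p r. c (foldl stepR p r) = foldl stepR (c p) r"
    and s: "\<And>k. s (Suc k) = c (s k)"
    and cm: "\<And>k. fold step as (s (Suc k)) = c (fold step as (s k))"
    and r: "reduced E (s 0)" and w: "walk E (hd (s 0)) as (hd (s 0))"
    and e: "converges s e"
  shows "fold stepi as e = e"
proof -
  define r where "r = tl (rev (s 0)) @ tl (fold step as (s 0))"
  have "fold step as (s k) = foldl stepR (s k) r" for k
  proof (induction k)
    case 0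
    show ?case unfolding r_def
      using reduced_act[OF r w] r by (subst foldl_stepR_connect[of E]) (auto dest: reduced_not_Nil)
  qed (simp add: c cm, simp add: s)
  then have "converges (\<lambda>k. fold step as (s k)) e" using converges_foldl[OF e, of r] by simp
  with converges_fold[OF e, of as] show ?thesis by (rule converges_unique)
qed

lemma stream_prefix_Suc_stepR: "reduced_stream E e \<Longrightarrow> n > 0 \<Longrightarrow> stepR (stream_prefix e n) (e n) = stream_prefix e (Suc n)"
  using foldl_stepR_append[of E "stream_prefix e n" "[e n]"] reduced_stream_red[of E e "Suc n"]
  by (auto simp: stream_prefix_Suc simp flip: length_greater_0_conv)

text \<open>
  A nontrivial deck transformation translates every end it fixes, hence its positive or its negative
  powers converge to that end.
\<close>

lemma commuting_fixes_end:
  assumes w: "walk E x ws x" and nt: "fold step ws [x] \<noteq> [x]"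
    and e: "reduced_stream E e" "e 0 = x" "fold stepi ws e = e"
    and wa: "walk E x as x"
    and comm: "\<And>p. reduced E p \<Longrightarrow> hd p = x \<Longrightarrow> fold step as (fold step ws p) = fold step ws (fold step as p)"
  shows "fold stepi as e = e"
proof -
  \<comment> \<open>Long enough for \<open>act_pre\<close>; from here on, prefixes of
    \<open>e\<close> are translated along \<open>e\<close>.\<close>
  define n where "n = Suc (length ws)"
  obtain n' where n': "n' > 0" "fold step ws (stream_prefix e n) = stream_prefix e n'" "\<And>i. e (n' + i) = e (n + i)"
    using act_pre[of ws n e] e(3) by (auto simp: n_def)
  have shift: "fold step ws (stream_prefix e (n + j)) = stream_prefix e (n' + j)" for j
  proof (induction j)
    case (Suc j)
    have "fold step ws (stream_prefix e (n + Suc j)) = fold step ws (foldl stepR (stream_prefix e (n + j)) [e (n + j)])"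
      using stream_prefix_Suc_stepR[OF e(1), of "n + j"] by (simp add: n_def)
    also have "\<dots> = stepR (stream_prefix e (n' + j)) (e (n' + j))"
      by (subst act_actR) (simp add: Suc n'(3))
    finally show ?case using stream_prefix_Suc_stepR[OF e(1), of "n' + j"] n'(1) by simp
  qed (simp add: n')
  have T: "reduced E (stream_prefix e m)" "hd (stream_prefix e m) = x" if "m > 0" for m
    using reduced_stream_red[OF e(1) that] e(2) that by (auto simp: hd_pre)
  consider "n' = n" | d where "d > 0" "n' = n + d" | d where "d > 0" "n = n' + d"
    by (metis less_imp_add_positive linorder_neqE_nat)
  then show ?thesis
  proof cases
    \<comment> \<open>Translation by zero fixes a point of the tree, which contradicts
      freeness.\<close>
    case 1
    then have "fold step ws [hd (stream_prefix e n)] = [hd (stream_prefix e n)]"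
      using n'(2) T(1)[of n] by (intro fix_root) (auto simp: n_def)
    with nt T(2)[of n] show ?thesis by (simp add: n_def)
  next
    case 2
    \<comment> \<open>The orbit of a prefix under the positive powers, which runs towards
      \<open>e\<close>.\<close>
    define s where "s k = stream_prefix e (n + k * d)" for k
    have s: "s (Suc k) = fold step ws (s k)" for k
      using shift[of "k * d"] 2 by (simp add: s_def algebra_simps)
    have Ts: "reduced E (s k)" "hd (s k) = x" for k using T[of "n + k * d"] by (auto simp: s_def n_def)
    show ?thesis
    proof (rule push_limit[where c = "fold step ws" and s = s])
      have "k \<le> n + k * d" for k using 2 by (simp add: trans_le_add2)
      then show "converges s e" using converges_pre[of "\<lambda>k. n + k * d" e] by (simp add: s_def[abs_def])
    qed (use Ts wa s comm in \<open>auto simp: act_actR\<close>)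
  next
    case 3
    \<comment> \<open>Here the translation points away from \<open>e\<close>, so the orbit of the
      inverse is used.\<close>
    define s where "s k = stream_prefix e (n' + k * d)" for k
    have s: "fold step ws (s (Suc k)) = s k" for k
      using shift[of "k * d"] 3 by (simp add: s_def algebra_simps)
    have Ts: "reduced E (s k)" "hd (s k) = x" for k using T[of "n' + k * d"] n' by (auto simp: s_def)
    show ?thesis
    proof (rule push_limit[where c = "fold step (rev_walk x ws)" and s = s])
      have "k \<le> n' + k * d" for k using 3 by (simp add: trans_le_add2)
      then show "converges s e" using converges_pre[of "\<lambda>k. n' + k * d" e] by (simp add: s_def[abs_def])
      show "s (Suc k) = fold step (rev_walk x ws) (s k)" for k
        using act_back[of "s (Suc k)" ws x] Ts w s[of k] by simp
      fix k
      have "fold step as (s k) = fold step ws (fold step as (s (Suc k)))"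
        using comm[OF Ts(1,2), of "Suc k"] s[of k] by simp
      then show "fold step as (s (Suc k)) = fold step (rev_walk x ws) (fold step as (s k))"
        using act_back[of "fold step as (s (Suc k))" ws x] reduced_act[of "s (Suc k)" as x] Ts wa w by simp
    qed (use Ts wa in \<open>auto simp: act_actR\<close>)
  qed
qed

lemma act_alt: "reduced E p \<Longrightarrow> hd p = x \<Longrightarrow> fold step (alternate (2 * n) y x) p = p"
  by (induction n) (auto dest: step_back[of p y])

end

section \<open>Closed walks in a tensor product\<close>

lemma zip_alt: "zip (alternate n a b) (alternate n c d) = alternate n (a, c) (b, d)"
  by (induction n arbitrary: a b c d) auto

lemma map_alt: "map f (alternate n a b) = alternate n (f a) (f b)"
  by (induction n arbitrary: a b) auto

text \<open>Connectedness and non-bipartiteness enter only as \<open>walksA\<close> and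
  \<open>walksB\<close>: walks of either parity between any two vertices.\<close>

locale tensor_coloring = square_free_edges E for E :: "('c \<times> 'c) set" +
  fixes A :: "('a \<times> 'a) set" and B :: "('b \<times> 'b) set" and VA :: "'a set" and VB :: "'b set"
    and f :: "'a \<times> 'b \<Rightarrow> 'c"
  assumes symA: "sym A" and symB: "sym B" and subA: "A \<subseteq> VA \<times> VA" and subB: "B \<subseteq> VB \<times> VB"
    and walksA: "g \<in> VA \<Longrightarrow> g' \<in> VA \<Longrightarrow> \<exists>us. even (length us) = c \<and> walk A g us g'"
    and walksB: "h \<in> VB \<Longrightarrow> h' \<in> VB \<Longrightarrow> \<exists>vs. even (length vs) = c \<and> walk B h vs h'"
    and hom: "(u, v) \<in> prod_edges A B \<Longrightarrow> (f u, f v) \<in> E"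
begin

abbreviation act :: "('a \<times> 'b) list \<Rightarrow> 'c list \<Rightarrow> 'c list" where
  "act W \<equiv> fold step (map f W)"

text \<open>Even length lets the second coordinate return to \<open>h\<close> by way of
  \<open>h'\<close>. It is enough to test the root, by \<open>fix_all\<close>.\<close>

definition trivialG :: bool where
  "trivialG \<longleftrightarrow> (\<forall>g h h' us. (h, h') \<in> B \<and> g \<in> VA \<and> even (length us) \<and> walk A g us g \<longrightarrow>
     act (zip us (alternate (length us) h' h)) [f (g, h)] = [f (g, h)])"

definition trivialH :: bool where
  "trivialH \<longleftrightarrow> (\<forall>g g' h vs. (g, g') \<in> A \<and> h \<in> VB \<and> even (length vs) \<and> walk B h vs h \<longrightarrow>
     act (zip (alternate (length vs) g' g) vs) [f (g, h)] = [f (g, h)])"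

lemma nbrA: "g \<in> VA \<Longrightarrow> \<exists>g'. (g, g') \<in> A"
  using walksA[of g g False] by (metis length_0_conv even_zero neq_Nil_conv walk.simps(2))

lemma nbrB: "h \<in> VB \<Longrightarrow> \<exists>h'. (h, h') \<in> B"
  using walksB[of h h False] by (metis length_0_conv even_zero neq_Nil_conv walk.simps(2))

lemma walk_hom: "walk (prod_edges A B) v W w \<Longrightarrow> walk E (f v) (map f W) (f w)"
  by (rule walk_map[OF _ hom])

lemma walk_pad:
  assumes "sym R" "walk R x us y" "(y, z) \<in> R" "length us \<le> n" "even n = even (length us)"
  shows "\<exists>us'. length us' = n \<and> walk R x us' y"
proof -
  have ev: "even (n - length us)" using assms by auto
  have "walk R x (us @ alternate (n - length us) z y) y"
    using walk_alt[OF assms(1,3), of "n - length us"] ev assms(2) by (auto simp: walk_append)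
  then show ?thesis using assms(4) by (intro exI[of _ "us @ alternate (n - length us) z y"]) auto
qed

text \<open>Walks of equal parity in the two factors can be padded to equal length by going back and
  forth at the end.\<close>

lemma walks_prod:
  assumes "v \<in> VA \<times> VB" "w \<in> VA \<times> VB"
  shows "\<exists>W. even (length W) = c \<and> walk (prod_edges A B) v W w"
proof -
  obtain g h g' h' where v: "v = (g, h)" "w = (g', h')" "g \<in> VA" "h \<in> VB" "g' \<in> VA" "h' \<in> VB"
    using assms by auto
  obtain us where us: "even (length us) = c" "walk A g us g'" using walksA v by blast
  obtain vs where vs: "even (length vs) = c" "walk B h vs h'" using walksB v by blast
  define n where "n = max (length us) (length vs)"
  have n: "even n = c" using us vs by (auto simp: n_def max_def)
  obtain z where "(g', z) \<in> A" using nbrA v by blast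
  then obtain us' where us': "length us' = n" "walk A g us' g'"
    using walk_pad[OF symA us(2), of z n] us n by (auto simp: n_def)
  obtain z where "(h', z) \<in> B" using nbrB v by blast
  then obtain vs' where vs': "length vs' = n" "walk B h vs' h'"
    using walk_pad[OF symB vs(2), of z n] vs n by (auto simp: n_def)
  show ?thesis using us' vs' n v by (intro exI[of _ "zip us' vs'"]) (auto simp: walk_zip)
qed

lemma walk_zip_alt:
  assumes "walk A w us g" "even (length us)" "(h, h') \<in> B"
  shows "walk (prod_edges A B) (w, h) (zip us (alternate (length us) h' h)) (g, h)"
  using assms walk_alt[OF symB assms(3), of "length us"] by (simp add: walk_zip)

lemma walk_zip_altH:
  assumes "walk B h vs h" "even (length vs)" "(g, g') \<in> A"
  shows "walk (prod_edges A B) (g, h) (zip (alternate (length vs) g' g) vs) (g, h)"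
  using assms walk_alt[OF symA assms(3), of "length vs"] by (simp add: walk_zip)

lemma shift_left:
  assumes "walk A g us g" "even (length vs)" "(g, g') \<in> A" "walk B h ws h" 
    "length ws = length us + length vs" "reduced E p" "hd p = f (g, h)"
  shows "act (zip (alternate (length vs) g' g @ us) ws) p = act (zip (us @ alternate (length vs) g' g) ws) p"
proof (rule flips_act_left[where f = f, OF _ assms(4) _ hom assms(6,7)])
  show "(alternate (length vs) g' g @ us, us @ alternate (length vs) g' g) \<in> flips A g g"
    using flips_shift_alt[OF symA assms(1,3,3), of "length vs div 2"] assms(2) by simp
  show "length (alternate (length vs) g' g @ us) = length ws" using assms(5) by simp
qed

lemma shift_right:
  assumes "walk B h vs h" "even (length us)" "(h, h') \<in> B" "walk A g ws g" 
    "length ws = length us + length vs" "reduced E p" "hd p = f (g, h)"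
  shows "act (zip ws (alternate (length us) h' h @ vs)) p = act (zip ws (vs @ alternate (length us) h' h)) p"
proof (rule flips_act_right[where f = f, OF _ assms(4) _ hom assms(6,7)])
  show "(alternate (length us) h' h @ vs, vs @ alternate (length us) h' h) \<in> flips B h h"
    using flips_shift_alt[OF symB assms(1,3,3), of "length us div 2"] assms(2) by simp
  show "length ws = length (alternate (length us) h' h @ vs)" using assms(5) by simp
qed

text \<open>In both products each coordinate performs its own walk and a filler, only in opposite
  order. Moving the filler past the walk is a homotopy of that coordinate alone, so the coordinates
  can be treated one after the other.\<close>

lemma factors_commute:
  assumes us: "walk A g us g" "even (length us)" and vs: "walk B h vs h" "even (length vs)"
    and e: "(g, g') \<in> A" "(h, h') \<in> B" and p: "reduced E p" "hd p = f (g, h)"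
  defines "a \<equiv> zip us (alternate (length us) h' h)" and "b \<equiv> zip (alternate (length vs) g' g) vs"
  shows "act b (act a p) = act a (act b p)"
proof -
  have wA: "walk A g (us @ alternate (length vs) g' g) g" "walk A g (alternate (length vs) g' g @ us) g"
    using us vs walk_alt[OF symA e(1), of "length vs"] by (auto simp: walk_append)
  have wB: "walk B h (alternate (length us) h' h @ vs) h"
    using us vs walk_alt[OF symB e(2), of "length us"] by (auto simp: walk_append)
  have "act b (act a p) = act (zip (us @ alternate (length vs) g' g) (alternate (length us) h' h @ vs)) p"
    by (simp add: a_def b_def)
  also have "\<dots> = act (zip (alternate (length vs) g' g @ us) (alternate (length us) h' h @ vs)) p"
    using shift_left[OF us(1) vs(2) e(1) wB _ p] by simp
  also have "\<dots> = act (zip (alternate (length vs) g' g @ us) (vs @ alternate (length us) h' h)) p"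
    using shift_right[OF vs(1) us(2) e(2) wA(2) _ p] by simp
  also have "\<dots> = act a (act b p)"
    by (simp add: a_def b_def)
  finally show ?thesis .
qed

text \<open>
  Closed walks of odd length do not split into closed walks of the two factors, but their squares do.
\<close>

lemma square_split:
  assumes W: "walk (prod_edges A B) (g, h) W (g, h)" and e: "(g, g') \<in> A" "(h, h') \<in> B"
    and p: "reduced E p" "hd p = f (g, h)"
  defines "us \<equiv> map fst W @ map fst W" and "vs \<equiv> map snd W @ map snd W"
  shows "act (zip (alternate (length vs) g' g) vs) (act (zip us (alternate (length us) h' h)) p) = act W (act W p)"
proof -
  have w: "walk A g us g" "walk B h vs h"
    using walk_prod_split[OF W] by (auto simp: us_def vs_def walk_append)
  have ev: "even (length us)" "even (length vs)" and l: "length us = length vs" by (auto simp: us_def vs_def)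
  have wA: "walk A g (us @ alternate (length vs) g' g) g"
    using w ev walk_alt[OF symA e(1), of "length vs"] by (auto simp: walk_append)
  have z: "zip us vs = W @ W" by (simp add: us_def vs_def zip_map_fst_snd)
  have "walk (prod_edges A B) (g, h) (zip us vs) (g, h)" using w l by (simp add: walk_zip)
  from reduced_act[OF p(1), of "map f (zip us vs)"] walk_hom[OF this] p
  have r: "reduced E (act (zip us vs) p)" "hd (act (zip us vs) p) = f (g, h)" by auto
  have "act (zip (alternate (length vs) g' g) vs) (act (zip us (alternate (length us) h' h)) p) =
     act (zip (us @ alternate (length vs) g' g) (alternate (length us) h' h @ vs)) p" by simp
  \<comment> \<open>With the second filler moved behind \<open>vs\<close>, both coordinates first
    walk together, along \<open>W\<close> twice, and then both fillers cancel.\<close>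
  also have "\<dots> = act (zip (us @ alternate (length vs) g' g) (vs @ alternate (length us) h' h)) p"
    using shift_right[OF w(2) ev(1) e(2) wA _ p] by simp
  also have "\<dots> = act (zip (alternate (length vs) g' g) (alternate (length us) h' h)) (act (zip us vs) p)"
    using l by simp
  also have "\<dots> = act (zip us vs) p"
    using act_alt[OF r, of "length us div 2" "f (g', h')"] l ev by (simp add: zip_alt map_alt)
  finally show ?thesis by (simp add: z)
qed

text \<open>\<open>trivialG\<close> and \<open>trivialH\<close> may fail at different base points,
  whereas commutation needs a common one. The witness is conjugated by a walk \<open>W\<close> in
  the product; the first coordinate of the conjugate folds up to a filler by
  \<open>flips_fold\<close>.\<close>

lemma nontrivial_at:
  assumes "\<not> trivialH" "g0 \<in> VA" "h0 \<in> VB" "(g0, g1) \<in> A"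
  shows "\<exists>vs. even (length vs) \<and> walk B h0 vs h0 \<and>
     act (zip (alternate (length vs) g1 g0) vs) [f (g0, h0)] \<noteq> [f (g0, h0)]"
proof -
  from assms(1) obtain g h g' vs where vs: "(g, g') \<in> A" "h \<in> VB" "even (length vs)" "walk B h vs h"
    and nt: "act (zip (alternate (length vs) g' g) vs) [f (g, h)] \<noteq> [f (g, h)]"
    unfolding trivialH_def by blast
  have "(g0, h0) \<in> VA \<times> VB" "(g, h) \<in> VA \<times> VB" using vs assms subA by auto
  from walks_prod[OF this] obtain W where W: "walk (prod_edges A B) (g0, h0) W (g, h)" by blast
  define U where "U = map fst W"
  define V where "V = map snd W"
  have UV: "walk A g0 U g" "walk B h0 V h" "length U = length V" "W = zip U V"
    using walk_prod_split[OF W] by (auto simp: U_def V_def zip_map_fst_snd)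
  define vs' where "vs' = V @ vs @ rev_walk h0 V"
  have w': "walk B h0 vs' h0"
    using UV vs walk_rev_walk[OF symB UV(2)] by (auto simp: vs'_def walk_append)
  have l': "length vs' = 2 * (length vs div 2 + length U)" using vs UV by (simp add: vs'_def)
  let ?x = "f (g0, h0)" and ?R = "rev_walk (f (g0, h0)) (map f W)" and ?b = "zip (alternate (length vs) g' g) vs"
  have "act (zip (U @ alternate (2 * (length vs div 2)) g' g @ rev_walk g0 U) vs') [?x] =
     act (zip (alternate (length vs') g1 g0) vs') [?x]"
    unfolding l' by (rule flips_act_left[OF flips_fold[OF symA UV(1) vs(1) assms(4)] w' _ hom])
      (use l' UV vs in auto)
  moreover have "act (zip (U @ alternate (2 * (length vs div 2)) g' g @ rev_walk g0 U) vs') [?x] =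
     fold step ?R (act ?b (act W [?x]))"
    using vs UV by (simp add: vs'_def map_rev_walk[symmetric] rev_walk_zip)
  moreover have "fold step ?R (act ?b (act W [?x])) \<noteq> [?x]"
  proof
    assume a: "fold step ?R (act ?b (act W [?x])) = [?x]"
    have wW: "walk E ?x (map f W) (f (g, h))" using W by (rule walk_hom)
    have r: "reduced E (act W [?x])" "hd (act W [?x]) = f (g, h)" using reduced_act[of "[?x]"] wW by auto
    have "walk E (f (g, h)) (map f ?b) (f (g, h))"
      using walk_zip_altH[OF vs(4,3,1)] by (rule walk_hom)
    then have r2: "reduced E (act ?b (act W [?x]))" "hd (act ?b (act W [?x])) = f (g, h)"
      using reduced_act[OF r(1)] r(2) by auto
    have "fold step ?R (act W [?x]) = [?x]" using act_back[of "[?x]" "map f W"] wW by auto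
    with a have "act ?b (act W [?x]) = act W [?x]"
      using act_inj[OF r2(1) r(1), of ?R ?x] r r2 walk_rev_walk[OF symE wW] by simp
    from fix_root[OF _ this] r nt show False by (auto dest: reduced_not_Nil)
  qed
  ultimately show ?thesis using w' l' by (intro exI[of _ vs']) auto
qed

lemma end_field:
  assumes fin: "finite E" and "\<not> trivialG" "\<not> trivialH"
  shows "\<exists>e. (\<forall>v\<in>VA \<times> VB. reduced_stream E (e v) \<and> e v 0 = f v) \<and>
     (\<forall>(u, v)\<in>prod_edges A B. e v = stepi (f v) (e u))"
proof -
  from assms(2) obtain g0 h0 h1 us where us: "(h0, h1) \<in> B" "g0 \<in> VA" "even (length us)" "walk A g0 us g0"
    and nta: "act (zip us (alternate (length us) h1 h0)) [f (g0, h0)] \<noteq> [f (g0, h0)]"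
    unfolding trivialG_def by blast
  have h0: "h0 \<in> VB" using us subB by auto
  obtain g1 where g1: "(g0, g1) \<in> A" using nbrA us by blast
  let ?x = "f (g0, h0)"
  define a where "a us = map f (zip us (alternate (length us) h1 h0))" for us
  define b where "b vs = map f (zip (alternate (length vs) g1 g0) vs)" for vs
  have wa: "walk E ?x (a us) ?x" if "walk A g0 us g0" "even (length us)" for us
    using walk_zip_alt[OF that us(1)] unfolding a_def by (rule walk_hom)
  have wb: "walk E ?x (b vs) ?x" if "walk B h0 vs h0" "even (length vs)" for vs
    using walk_zip_altH[OF that g1] unfolding b_def by (rule walk_hom)
  have comm: "fold step (b vs) (fold step (a us) p) = fold step (a us) (fold step (b vs) p)"
    if "walk A g0 us g0" "even (length us)" "walk B h0 vs h0" "even (length vs)" "reduced E p" "hd p = ?x" for us vs p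
    using factors_commute[OF that(1-4) g1 us(1) that(5,6)] by (simp add: a_def b_def)
  obtain e where ce: "converges (\<lambda>k. (fold step (a us) ^^ k) [?x]) e"
    using power_limit[OF fin wa[OF us(4,3)]] nta by (auto simp: a_def)
  have T: "reduced E ((fold step (a us) ^^ k) [?x])" "hd ((fold step (a us) ^^ k) [?x]) = ?x" for k
    using act_funpow_red[OF wa[OF us(4,3)], of "[?x]" k] by auto
  have e: "reduced_stream E e" using converges_redi[OF ce T(1)] .
  have e0: "e 0 = ?x"
  proof -
    obtain k where "Suc 0 \<le> length ((fold step (a us) ^^ k) [?x])"
      "take 1 ((fold step (a us) ^^ k) [?x]) = stream_prefix e 1"
      using ce unfolding converges_def by (metis One_nat_def order_refl)
    then show ?thesis using T(2)[of k] by (cases "(fold step (a us) ^^ k) [?x]") (auto simp: stream_prefix_def)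
  qed
  have fb: "fold stepi (b vs) e = e" if vs: "walk B h0 vs h0" "even (length vs)" for vs
  proof (rule push_limit[where c = "fold step (a us)", OF _ _ _ _ _ ce])
    show "fold step (b vs) ((fold step (a us) ^^ Suc k) [?x]) = fold step (a us) (fold step (b vs) ((fold step (a us) ^^ k) [?x]))" for k
      using comm[OF us(4,3) vs T] by simp
  qed (use wb[OF vs] in \<open>auto simp: act_actR\<close>)
  obtain vs where vs: "even (length vs)" "walk B h0 vs h0" and ntb: "fold step (b vs) [?x] \<noteq> [?x]"
    using nontrivial_at[OF assms(3) us(2) h0 g1] by (auto simp: b_def)
  \<comment> \<open>\<open>a us'\<close> need not commute with \<open>a us\<close>, but it commutes
    with the nontrivial \<open>b vs\<close>, which fixes \<open>e\<close>.\<close>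
  have fa: "fold stepi (a us') e = e" if us': "walk A g0 us' g0" "even (length us')" for us'
    by (rule commuting_fixes_end[OF wb[OF vs(2,1)] ntb e e0 fb[OF vs(2,1)] wa[OF us']])
      (use comm[OF us' vs(2,1)] in simp)
  have fc: "fold stepi (map f W) e = e" if W: "walk (prod_edges A B) (g0, h0) W (g0, h0)" for W
  proof -
    define us' where "us' = map fst W @ map fst W"
    define vs' where "vs' = map snd W @ map snd W"
    have w: "walk A g0 us' g0" "even (length us')" "walk B h0 vs' h0" "even (length vs')"
      using walk_prod_split[OF W] by (auto simp: us'_def vs'_def walk_append)
    have wW: "walk E ?x (map f W) ?x" using W by (rule walk_hom)
    have "fold stepi (map f W @ map f W) e = fold stepi (a us' @ b vs') e"
      by (rule acti_cong[OF e]) (use square_split[OF W g1 us(1)] e0 in \<open>auto simp: a_def b_def us'_def vs'_def\<close>)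
    then have fix2: "fold stepi (map f W @ map f W) e = e" using fa[OF w(1,2)] fb[OF w(3,4)] by simp
    show ?thesis
    \<comment> \<open>A closed walk commutes with its own square. If the square is trivial, so is
      the walk, by torsion-freeness.\<close>
    proof (cases "fold step (map f W @ map f W) [?x] = [?x]")
      case True
      then have "fold step (map f W) [?x] = [?x]"
        using torsion_free[OF wW, of 2] by (simp add: numeral_2_eq_2)
      then have "fold stepi (map f W) e = fold stepi [] e"
        by (intro acti_cong[OF e]) (use e0 fix_all in auto)
      then show ?thesis by simp
    next
      case False
      show ?thesis
        by (rule commuting_fixes_end[OF _ False e e0 fix2 wW]) (use wW in \<open>auto simp: walk_append\<close>)
    qed
  qed
  have "\<exists>W. walk (prod_edges A B) (g0, h0) W v" if "v \<in> VA \<times> VB" for v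
    using walks_prod[of "(g0, h0)" v True] that us(2) h0 by auto
  then obtain W where W: "\<And>v. v \<in> VA \<times> VB \<Longrightarrow> walk (prod_edges A B) (g0, h0) (W v) v" by metis
  \<comment> \<open>The end is carried from the base vertex to \<open>v\<close> along an arbitrary
    walk; \<open>fc\<close> makes the choice irrelevant.\<close>
  define ee where "ee v = fold stepi (map f (W v)) e" for v
  have 1: "reduced_stream E (ee v) \<and> ee v 0 = f v" if "v \<in> VA \<times> VB" for v
    using reduced_stream_acti[OF e, of "map f (W v)" "f v"] walk_hom[OF W[OF that]] e0 by (simp add: ee_def)
  have 2: "ee v = stepi (f v) (ee u)" if "(u, v) \<in> prod_edges A B" for u v
  proof -
    have uv: "u \<in> VA \<times> VB" "v \<in> VA \<times> VB" using that subA subB by (auto simp: prod_edges_def)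
    let ?R = "rev_walk ?x (map f (W v))"
    have symP: "sym (prod_edges A B)" using symA symB by (auto simp: sym_def)
    have wR: "walk E (f v) ?R ?x" using walk_rev_walk[OF symE walk_hom[OF W[OF uv(2)]]] .
    \<comment> \<open>Out to \<open>u\<close>, over the edge to \<open>v\<close>, and back along the
      walk chosen for \<open>v\<close>.\<close>
    have c: "walk (prod_edges A B) (g0, h0) (W u @ [v] @ rev_walk (g0, h0) (W v)) (g0, h0)"
      by (rule walk_appendI[OF W[OF uv(1)]]) (use walk_rev_walk[OF symP W[OF uv(2)]] that in simp)
    let ?z = "stepi (f v) (ee u)"
    have z: "reduced_stream E ?z" "?z 0 = f v" using 1[OF uv(1)] hom[OF that] by (auto simp: reduced_stream_stepi stepi_0)
    have "fold stepi ?R ?z = e" using fc[OF c] by (simp add: ee_def map_rev_walk)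
    moreover have "fold stepi ?R (ee v) = e"
      using acti_back[OF e, of "map f (W v)"] walk_hom[OF W[OF uv(2)]] e0 by (simp add: ee_def)
    ultimately show ?thesis
      using acti_back[OF z(1), of ?R ?x] acti_back[of "ee v" ?R ?x] 1[OF uv(2)] z(2) wR by simp
  qed
  from 1 2 show ?thesis by (intro exI[of _ ee]) auto
qed

end

section \<open>Contracting the layers\<close>

lemma rev_walk_alt: "rev_walk b (alternate n a b) = (if even n then alternate n a b else alternate n b a)"
proof (induction n arbitrary: a b)
  case (Suc n)
  have "alternate n x y @ [if even n then x else y] = alternate (Suc n) x y" for x y :: 'a
    using alternate_append[of n 1 x y] by auto
  from this[of a b] this[of b a] show ?case using Suc[of a b] by (auto split: if_splits)
qed simp

context tensor_coloring
begin

text \<open>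
  If closed walks in the first factor act trivially, then each layer \<open>h\<close> lifts to the universal cover,
  and \<open>geodesic h g w\<close> is the geodesic between the lifts of \<open>(g, h)\<close> and \<open>(w, h)\<close>.
\<close>

definition geodesic :: "'b \<Rightarrow> 'a \<Rightarrow> 'a \<Rightarrow> 'c list" where
  "geodesic h g w = (SOME p. \<exists>us h'. even (length us) \<and> walk A w us g \<and> (h, h') \<in> B \<and>
     p = act (zip us (alternate (length us) h' h)) [f (w, h)])"

text \<open>A change of the filler edge is a homotopy, and two walks with the same ends differ by a
  closed walk, which acts trivially.\<close>

lemma geodesic_unique:
  assumes tr: "trivialG" and w: "w \<in> VA"
    and 1: "even (length us)" "walk A w us g" "(h, h1) \<in> B"
    and 2: "even (length us')" "walk A w us' g" "(h, h2) \<in> B"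
  shows "act (zip us (alternate (length us) h1 h)) [f (w, h)] = act (zip us' (alternate (length us') h2 h)) [f (w, h)]"
proof -
  let ?x = "f (w, h)"
  have "act (zip us (alternate (2 * (length us div 2)) h1 h)) [?x] = act (zip us (alternate (2 * (length us div 2)) h2 h)) [?x]"
    by (rule flips_act_right[where f = f, OF flips_alt[OF symB 1(3) 2(3)] 1(2) _ hom]) (use 1 in auto)
  then have e1: "act (zip us (alternate (length us) h1 h)) [?x] = act (zip us (alternate (length us) h2 h)) [?x]"
    using 1 by simp
  let ?R = "rev_walk w us'" and ?W = "zip us (alternate (length us) h2 h)" and ?W' = "zip us' (alternate (length us') h2 h)"
  have R: "walk A g ?R w" using walk_rev_walk[OF symA 2(2)] .
  have al: "alternate (length us + length us') h2 h = alternate (length us) h2 h @ alternate (length us') h2 h"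
    using 1 by (simp add: alternate_append)
  have rw: "rev_walk ?x (map f ?W') = map f (zip ?R (alternate (length us') h2 h))"
    using 2(1) by (simp add: map_rev_walk[symmetric] rev_walk_zip rev_walk_alt)
  have "act (zip (us @ ?R) (alternate (length (us @ ?R)) h2 h)) [?x] = [?x]"
    using 1 2 w R by (intro tr[unfolded trivialG_def, rule_format]) (auto simp: walk_append)
  then have "fold step (rev_walk ?x (map f ?W')) (act ?W [?x]) = [?x]"
    unfolding rw by (simp add: al)
  moreover have wW: "walk E ?x (map f ?W) (f (g, h))" "walk E ?x (map f ?W') (f (g, h))"
    using walk_hom[OF walk_zip_alt[OF 1(2,1) 2(3)]] walk_hom[OF walk_zip_alt[OF 2(2,1) 2(3)]] by blast+
  moreover have "fold step (rev_walk ?x (map f ?W')) (act ?W' [?x]) = [?x]"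
    using act_back[of "[?x]" "map f ?W'"] wW(2) by simp
  ultimately have eq: "fold step (rev_walk ?x (map f ?W')) (act ?W [?x]) = fold step (rev_walk ?x (map f ?W')) (act ?W' [?x])"
    by (simp only:)
  have r: "reduced E (act ?W [?x])" "hd (act ?W [?x]) = f (g, h)" "reduced E (act ?W' [?x])" "hd (act ?W' [?x]) = f (g, h)"
    using reduced_act[of "[?x]" "map f ?W"] reduced_act[of "[?x]" "map f ?W'"] wW by simp_all
  have "act ?W [?x] = act ?W' [?x]"
    by (rule act_inj[OF r(1,3) _ _ eq]) (use r walk_rev_walk[OF symE wW(2)] in simp_all)
  with e1 show ?thesis by simp
qed

lemma geodesic_eq:
  assumes "trivialG" "w \<in> VA" "even (length us)" "walk A w us g" "(h, h') \<in> B"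
  shows "geodesic h g w = act (zip us (alternate (length us) h' h)) [f (w, h)]"
proof -
  have "\<exists>p us h'. even (length us) \<and> walk A w us g \<and> (h, h') \<in> B \<and>
     p = act (zip us (alternate (length us) h' h)) [f (w, h)]" using assms by blast
  from someI_ex[OF this] obtain us2 h2 where "even (length us2)" "walk A w us2 g" "(h, h2) \<in> B"
    "geodesic h g w = act (zip us2 (alternate (length us2) h2 h)) [f (w, h)]" unfolding geodesic_def by blast
  with geodesic_unique[OF assms(1,2), of us2 g h h2 us h'] assms show ?thesis by simp
qed

lemma geodesic_props:
  assumes tr: "trivialG" and V: "g \<in> VA" "w \<in> VA" "h \<in> VB"
  shows "reduced E (geodesic h g w)" "hd (geodesic h g w) = f (g, h)" "last (geodesic h g w) = f (w, h)" "odd (length (geodesic h g w))"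
proof -
  obtain us where us: "even (length us)" "walk A w us g" using walksA[OF V(2,1), of True] by auto
  obtain h' where h': "(h, h') \<in> B" using nbrB V by blast
  have geodesic: "geodesic h g w = act (zip us (alternate (length us) h' h)) [f (w, h)]" using geodesic_eq[OF tr V(2) us h'] .
  have "walk E (f (w, h)) (map f (zip us (alternate (length us) h' h))) (f (g, h))"
    using walk_zip_alt[OF us(2,1) h'] by (rule walk_hom)
  then show "reduced E (geodesic h g w)" "hd (geodesic h g w) = f (g, h)" unfolding geodesic using reduced_act[of "[f (w, h)]"] by auto
  show "last (geodesic h g w) = f (w, h)" unfolding geodesic by (simp add: last_act)
  show "odd (length (geodesic h g w))" unfolding geodesic using us by (simp add: parity_act)
qed

lemma geodesic_refl: "trivialG \<Longrightarrow> g \<in> VA \<Longrightarrow> h \<in> VB \<Longrightarrow> geodesic h g g = [f (g, h)]"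
  using geodesic_eq[of g "[]" g h] nbrB[of h] by auto

lemma geodesic_act:
  assumes tr: "trivialG" and V: "w \<in> VA" "u \<in> VA" and us: "even (length us)" "walk A w us g" "(h, h') \<in> B"
  shows "act (zip us (alternate (length us) h' h)) (geodesic h w u) = geodesic h g u"
proof -
  obtain us0 where us0: "even (length us0)" "walk A u us0 w" using walksA[OF V(2,1), of True] by auto
  have "geodesic h g u = act (zip (us0 @ us) (alternate (length (us0 @ us)) h' h)) [f (u, h)]"
    using us us0 by (intro geodesic_eq tr V) (auto simp: walk_append simp del: zip_append)
  also have "\<dots> = act (zip us (alternate (length us) h' h)) (geodesic h w u)"
    using geodesic_eq[OF tr V(2) us0 us(3)] us0(1) by (simp add: alternate_append)
  finally show ?thesis by simp
qed

lemma geodesic_triangle: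
  assumes tr: "trivialG" and V: "g \<in> VA" "w \<in> VA" "u \<in> VA" "h \<in> VB"
  shows "geodesic h g u = foldl stepR (geodesic h g w) (tl (geodesic h w u))"
proof -
  obtain us where us: "even (length us)" "walk A w us g" using walksA[OF V(2,1), of True] by auto
  obtain h' where h': "(h, h') \<in> B" using nbrB V by blast
  show ?thesis
    using geodesic_act[OF tr V(2,3) us h'] geodesic_eq[OF tr V(2) us h'] act_from_root[OF geodesic_props(1)[OF tr V(2,3,4)]]
      geodesic_props(2)[OF tr V(2,3,4)] by simp
qed

lemma geodesic_sym:
  assumes tr: "trivialG" and V: "g \<in> VA" "w \<in> VA" "h \<in> VB"
  shows "geodesic h w g = rev (geodesic h g w)"
proof -
  obtain us where us: "even (length us)" "walk A w us g" using walksA[OF V(2,1), of True] by auto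
  obtain h' where h': "(h, h') \<in> B" using nbrB V by blast
  let ?W = "map f (zip us (alternate (length us) h' h))"
  have "walk E (f (w, h)) ?W (f (g, h))" using walk_zip_alt[OF us(2,1) h'] by (rule walk_hom)
  from walk_last[OF this] act_rev_walk[of "f (w, h)" ?W]
  have "fold step (rev_walk (f (w, h)) ?W) [f (g, h)] = rev (geodesic h g w)"
    using geodesic_eq[OF tr V(2) us h'] by simp
  moreover have "rev_walk (f (w, h)) ?W = map f (zip (rev_walk w us) (alternate (length us) h' h))"
    using us by (simp add: map_rev_walk[symmetric] rev_walk_zip rev_walk_alt)
  ultimately show ?thesis
    using geodesic_eq[OF tr V(1), of "rev_walk w us" w h h'] walk_rev_walk[OF symA us(2)] us(1) h' by simp
qed

text \<open>A walk from \<open>w'\<close> to \<open>g'\<close> may pass through \<open>w\<close> and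
  \<open>g\<close>. Its inner part belongs to the layer \<open>h\<close>, and its two outer edges
  act on the two ends of the geodesic. This couples neighbouring layers.\<close>

lemma geodesic_rec:
  assumes tr: "trivialG" and e: "(h, h') \<in> B" "(g, g') \<in> A" "(w, w') \<in> A"
  shows "geodesic h' g' w' = step (f (g', h')) (stepR (geodesic h g w) (f (w', h')))"
proof -
  have V: "g \<in> VA" "g' \<in> VA" "w \<in> VA" "w' \<in> VA" "h' \<in> VB" using e subA subB by auto
  obtain us where us: "even (length us)" "walk A w us g" using walksA[OF V(3,1), of True] by auto
  have e': "(h', h) \<in> B" "(w', w) \<in> A" using symD[OF symB e(1)] symD[OF symA e(3)] by auto
  have al: "alternate (length us + 1) h' h = alternate (length us) h' h @ [h']" using us(1) by (simp only: alternate_append) simp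
  have "geodesic h' g' w' = act (zip (w # us @ [g']) (alternate (length (w # us @ [g'])) h h')) [f (w', h')]"
    using e e' us V by (intro geodesic_eq tr) (auto simp: walk_append)
  also have "\<dots> = step (f (g', h')) (act (zip us (alternate (length us) h' h)) [f (w, h), f (w', h')])"
    using al by simp
  also have "act (zip us (alternate (length us) h' h)) [f (w, h), f (w', h')] = stepR (geodesic h g w) (f (w', h'))"
    using act_actR[of _ "[f (w, h)]" "[f (w', h')]"] geodesic_eq[OF tr V(3) us e(1)] by (simp add: stepR_def[of "[_]"])
  finally show ?thesis .
qed

text \<open>The measure for the contraction: at its least possible value all geodesics are single
  points, so the layers are constant.\<close>

definition spread :: nat where
  "spread = (\<Sum>(h, g, w)\<in>VB \<times> VA \<times> VA. length (geodesic h g w))"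

text \<open>With even walks to all vertices, the sum of their lengths is an even bound to which each
  of them can be padded.\<close>

lemma walks_of_common_length:
  assumes "finite VA" "a \<in> VA"
  shows "\<exists>n. \<forall>y\<in>VA. \<exists>us. length us = n \<and> walk A a us y"
proof -
  have "\<forall>y\<in>VA. \<exists>us. even (length us) \<and> walk A a us y" using walksA[OF assms(2), of _ True] by simp
  then obtain us where us: "\<And>y. y \<in> VA \<Longrightarrow> even (length (us y)) \<and> walk A a (us y) y" by metis
  let ?n = "\<Sum>y\<in>VA. length (us y)"
  have ev: "even ?n" using us by (auto intro: dvd_sum)
  have "\<exists>vs. length vs = ?n \<and> walk A a vs y" if y: "y \<in> VA" for y
  proof -
    obtain z where "(y, z) \<in> A" using nbrA y by blast
    moreover have "length (us y) \<le> ?n" using assms(1) y by (intro member_le_sum) auto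
    ultimately show ?thesis using walk_pad[OF symA, of a "us y" y z ?n] us[OF y] ev by simp
  qed
  then show ?thesis by blast
qed

text \<open>
  If every farthest point \<open>x\<close> of every layer had a neighbour that is still farther away, then in the layer
  of that neighbour the points opposite to \<open>x\<close> would include all neighbours of the previous
  opposite points. As the factor is connected and not bipartite, these would eventually be all points.
\<close>

lemma unstuck_geodesic:
  assumes tr: "trivialG" and fin: "finite VA"
    and M: "M \<ge> 3" and max: "\<And>h g w. h \<in> VB \<Longrightarrow> g \<in> VA \<Longrightarrow> w \<in> VA \<Longrightarrow> length (geodesic h g w) \<le> M"
    and att: "h0 \<in> VB" "g0 \<in> VA" "a0 \<in> VA" "length (geodesic h0 g0 a0) = M"
  shows "\<exists>h\<in>VB. \<exists>g1\<in>VA. \<exists>a\<in>VA. length (geodesic h g1 a) = M \<and>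
     (\<forall>g g' h'. geodesic h g a = geodesic h g1 a \<and> (g, g') \<in> A \<and> (h, h') \<in> B \<longrightarrow> f (g', h') = geodesic h g1 a ! 1)"
proof (rule ccontr)
  assume "\<not> ?thesis"
  then have stuck: "\<exists>g g' h'. geodesic h g a = geodesic h g1 a \<and> (g, g') \<in> A \<and> (h, h') \<in> B \<and> f (g', h') \<noteq> geodesic h g1 a ! 1"
    if "h \<in> VB" "g1 \<in> VA" "a \<in> VA" "length (geodesic h g1 a) = M" for h g1 a
    using that by blast
  have chain: "\<exists>h\<in>VB. \<exists>g\<in>VA. \<exists>x. length x = M \<and> (\<forall>us a. length us = n \<and> walk A a0 us a \<longrightarrow> geodesic h g a = x)" for n
  proof (induction n)
    case 0
    then show ?case using att by (intro bexI[of _ h0] bexI[of _ g0]) auto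
  next
    case (Suc n)
    then obtain h g x where hg: "h \<in> VB" "g \<in> VA" "length x = M"
      and x: "\<And>us a. length us = n \<Longrightarrow> walk A a0 us a \<Longrightarrow> geodesic h g a = x" by blast
    obtain z where z: "(a0, z) \<in> A" using nbrA att by blast
    obtain us a where us: "length us = n" "walk A a0 us a"
      using walk_alt[OF symA z, of n] length_alt[of n z a0] by blast
    have a: "a \<in> VA" using walk_in[OF us(2) subA att(3)] .
    obtain g2 g' h' where g2: "geodesic h g2 a = x" "(g2, g') \<in> A" "(h, h') \<in> B" "f (g', h') \<noteq> x ! 1"
      using stuck[OF hg(1,2) a] x[OF us] hg(3) by auto
    have g2V: "g2 \<in> VA" "g' \<in> VA" "h' \<in> VB" using g2 subA subB by auto
    define x' where "x' = f (g', h') # butlast x"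
    have "geodesic h' g' c = x'" if vs: "length vs = Suc n" "walk A a0 vs c" for vs c
    proof -
      obtain vs' z where "vs = vs' @ [z]" using vs(1) by (cases vs rule: rev_cases) auto
      with vs obtain b where b: "length vs' = n" "walk A a0 vs' b" "(b, c) \<in> A" by (auto simp: walk_append)
      have bV: "b \<in> VA" "c \<in> VA" using b(3) subA by auto
      \<comment> \<open>\<open>g2\<close> and \<open>g\<close> have the same lift, because they have
        the same geodesic to \<open>a\<close>.\<close>
      have "geodesic h g2 b = geodesic h g b"
        using geodesic_triangle[OF tr g2V(1) a bV(1) hg(1)] geodesic_triangle[OF tr hg(2) a bV(1) hg(1)] g2(1) x[OF us] by simp
      then have Lb: "geodesic h g2 b = x" using x[OF b(1,2)] by simp
      have rec: "geodesic h' g' c = step (f (g', h')) (stepR x (f (c, h')))"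
        using geodesic_rec[OF tr g2(3,2) b(3)] Lb by simp
      \<comment> \<open>The geodesic grows at the end of \<open>g'\<close>; so by maximality of
        \<open>M\<close> it must shrink at the other end, whichever neighbour \<open>c\<close> is.
        Hence the result \<open>x'\<close> does not depend on \<open>c\<close>.\<close>
      have "2 \<le> length x \<and> x ! (length x - 2) = f (c, h')"
      proof (rule ccontr)
        assume n: "\<not> ?thesis"
        then have "stepR x (f (c, h')) = x @ [f (c, h')]" by (simp only: stepR_def if_False)
        then have "geodesic h' g' c = f (g', h') # x @ [f (c, h')]"
          using rec g2(4) hg(3) M by (simp add: step_def nth_append)
        then have "length (geodesic h' g' c) = M + 2" using hg(3) by simp
        then show False using max[OF g2V(3,2) bV(2)] by simp
      qed
      then have "stepR x (f (c, h')) = butlast x" by (simp only: stepR_def if_True simp_thms)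
      then show ?thesis using rec g2(4) hg(3) M by (simp add: step_def nth_butlast x'_def)
    qed
    moreover have "length x' = M" using hg(3) M by (simp add: x'_def)
    ultimately show ?case using g2V by blast
  qed
  obtain n where n: "\<forall>y\<in>VA. \<exists>us. length us = n \<and> walk A a0 us y" using walks_of_common_length[OF fin att(3)] by blast
  obtain h g x where hg: "h \<in> VB" "g \<in> VA" "length x = M"
    and x: "\<forall>us a. length us = n \<and> walk A a0 us a \<longrightarrow> geodesic h g a = x" using chain[of n] by blast
  \<comment> \<open>Once all vertices are opposite points, \<open>g\<close> would be at maximal
    distance from itself.\<close>
  have "geodesic h g g = x" using n x hg(2) by blast
  then show False using geodesic_refl[OF tr hg(2,1)] hg(3) M by auto
qed

text \<open>All vertices of one layer that lift to the same farthest point move together, two edges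
  inwards from \<open>x0\<close> to \<open>x2\<close>. Their neighbours all have the color
  \<open>x1\<close>, so this is a coloring. No geodesic grows, and the one to \<open>a\<close>
  shrinks.\<close>

lemma smaller_spread:
  assumes tr: "trivialG" and fin: "finite VA" "finite VB" and irrB: "\<And>h. (h, h) \<notin> B"
    and nt: "h0 \<in> VB" "g0 \<in> VA" "w0 \<in> VA" "length (geodesic h0 g0 w0) \<noteq> 1"
  shows "\<exists>f'. tensor_coloring E A B VA VB f' \<and> tensor_coloring.trivialG A B VA f' \<and>
     (\<forall>(u, v)\<in>prod_edges A B. f u = f' u \<or> f v = f' v) \<and> tensor_coloring.spread A B VA VB f' < spread"
proof -
  let ?T = "VB \<times> VA \<times> VA"
  let ?l = "\<lambda>(h, g, w). length (geodesic h g w)"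
  define M where "M = Max (?l ` ?T)"
  have finT: "finite ?T" using fin by simp
  have max: "length (geodesic h g w) \<le> M" if "h \<in> VB" "g \<in> VA" "w \<in> VA" for h g w
    unfolding M_def using finT that by (intro Max_ge) (auto intro!: image_eqI[of _ _ "(h, g, w)"])
  have "M \<in> ?l ` ?T" unfolding M_def using finT nt by (intro Max_in) auto
  then obtain h1 g1 a1 where att: "h1 \<in> VB" "g1 \<in> VA" "a1 \<in> VA" "length (geodesic h1 g1 a1) = M" by auto
  have M: "M \<ge> 3"
  proof -
    have "length (geodesic h0 g0 w0) \<noteq> 2" using geodesic_props(4)[OF tr nt(2,3,1)] by auto
    moreover have "length (geodesic h0 g0 w0) \<noteq> 0" using geodesic_props(1)[OF tr nt(2,3,1)] by auto
    ultimately show ?thesis using max[OF nt(1-3)] nt(4) by linarith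
  qed
  obtain h g1 a where hga: "h \<in> VB" "g1 \<in> VA" "a \<in> VA" "length (geodesic h g1 a) = M"
    and un: "\<And>g g' h'. geodesic h g a = geodesic h g1 a \<Longrightarrow> (g, g') \<in> A \<Longrightarrow> (h, h') \<in> B \<Longrightarrow> f (g', h') = geodesic h g1 a ! 1"
    using unstuck_geodesic[OF tr fin(1) M max att] by blast
  define x where "x = geodesic h g1 a"
  have xr: "reduced E x" "length x = M" using geodesic_props(1)[OF tr hga(2,3,1)] hga(4) by (auto simp: x_def)
  obtain x0 x1 x2 xs where xx: "x = x0 # x1 # x2 # xs"
    using xr(2) M by (cases x; cases "tl x"; cases "tl (tl x)") auto
  have x12: "(x1, x2) \<in> E" using xr xx by auto
  \<comment> \<open>Moving \<open>g1\<close> alone would lengthen its geodesics to the other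
    vertices with the same lift.\<close>
  define X where "X = {g \<in> VA. geodesic h g a = x}"
  define C where "C = X \<times> {h}"
  define f' where "f' v = (if v \<in> C then x2 else f v)" for v
  have nbX: "f (g', h') = x1" if "g \<in> X" "(g, g') \<in> A" "(h, h') \<in> B" for g g' h'
    using un[of g g' h'] that by (auto simp: X_def x_def[symmetric] xx)
  have unch: "f' v = f v" if "v \<notin> C" for v using that by (simp add: f'_def)
  have ind: "u \<notin> C \<or> v \<notin> C" if "(u, v) \<in> prod_edges A B" for u v
    using that irrB by (auto simp: prod_edges_def C_def)
  have symP: "sym (prod_edges A B)" using symA symB by (auto simp: sym_def)
  have nbC: "f v = x1" if "(u, v) \<in> prod_edges A B" "u \<in> C" for u v
    using that nbX by (auto simp: prod_edges_def C_def)
  have hom': "(f' u, f' v) \<in> E" if e: "(u, v) \<in> prod_edges A B" for u v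
  proof -
    have e': "(v, u) \<in> prod_edges A B" using symD[OF symP e] .
    consider "u \<in> C" "v \<notin> C" | "u \<notin> C" "v \<in> C" | "u \<notin> C" "v \<notin> C" using ind[OF e] by blast
    then show ?thesis
    proof cases
      case 1
      then show ?thesis using nbC[OF e] symD[OF symE x12] by (simp add: f'_def)
    next
      case 2
      then show ?thesis using nbC[OF e'] x12 by (simp add: f'_def)
    next
      case 3
      then show ?thesis using hom[OF e] by (simp add: f'_def)
    qed
  qed
  interpret F: tensor_coloring E A B VA VB f'
    by unfold_locales (use symA symB subA subB walksA walksB hom' in auto)
  \<comment> \<open>\<open>C\<close> is independent, so the recoloring makes isolated changes; walks
    between unchanged vertices act as before.\<close>
  have iso: "isolated_diff (map f W) (map f' W)" if "walk (prod_edges A B) v W w" "w \<notin> C" for v W w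
    using that
  proof (induction W arbitrary: v rule: induct_list012)
    case (3 y z W)
    show ?case
    proof (cases "y \<in> C")
      case True
      then have "z \<notin> C" using ind[of y z] 3(3) by simp
      moreover have "isolated_diff (map f W) (map f' W)" using 3(1)[of z] 3(3,4) by simp
      ultimately show ?thesis by (simp add: unch isolated_diff_diff)
    next
      case False
      moreover have "isolated_diff (map f (z # W)) (map f' (z # W))" using 3(2)[of y] 3(3,4) by simp
      ultimately show ?thesis by (simp add: unch isolated_diff_same)
    qed
  qed (auto simp: unch intro: isolated_diff.intros)
  have same: "act W p = F.act W p"
    if "walk (prod_edges A B) v W w" "v \<notin> C" "w \<notin> C" "reduced E p" "hd p = f v" for v W w p
    by (rule isolated_diff_act[OF iso[OF that(1,3)]])
      (use walk_hom[OF that(1)] F.walk_hom[OF that(1)] unch[OF that(2)] unch[OF that(3)] that(4,5) in auto)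
  have tr': "F.trivialG"
    unfolding F.trivialG_def
  proof (intro allI impI, elim conjE)
    fix g k k' us assume k: "(k, k') \<in> B" and g: "g \<in> VA" and us: "even (length us)" "walk A g us g"
    let ?W = "zip us (alternate (length us) k' k)" and ?v = "(g, k)"
    have wW: "walk (prod_edges A B) ?v ?W ?v" using walk_zip_alt[OF us(2,1) k] .
    show "F.act ?W [f' ?v] = [f' ?v]"
    proof (cases "?v \<in> C")
      case False
      have "act ?W [f ?v] = [f ?v]" using tr k g us unfolding trivialG_def by blast
      then show ?thesis using same[OF wW False False] unch[OF False] by simp
    next
      case True
      \<comment> \<open>The base vertex is recolored. Conjugating by an edge moves the closed walk
        to a neighbour outside \<open>C\<close>, where the old triviality applies.\<close>
      obtain g2 where g2: "(g, g2) \<in> A" using nbrA g by blast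
      let ?u = "(g2, k')"
      have e: "(?v, ?u) \<in> prod_edges A B" using g2 k by simp
      then have u: "?u \<notin> C" using ind True by blast
      have e': "(?u, ?v) \<in> prod_edges A B" using symD[OF symP e] .
      have al: "alternate (length us + 1) k' k = alternate (length us) k' k @ [k']"
        using us(1) by (simp only: alternate_append) simp
      have wW2: "walk (prod_edges A B) ?u (?v # ?W @ [?u]) ?u"
        using e e' wW by (auto simp: walk_append)
      have "act (zip (g # us @ [g2]) (alternate (length (g # us @ [g2])) k k')) [f ?u] = [f ?u]"
        using tr e' us g2 subA unfolding trivialG_def
        by (intro tr[unfolded trivialG_def, rule_format]) (auto simp: walk_append)
      then have "act (?v # ?W @ [?u]) [f ?u] = [f ?u]" using al by simp
      then have "F.act (?v # ?W @ [?u]) [f ?u] = [f ?u]" using same[OF wW2 u u, of "[f ?u]"] by simp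
      then have st: "step (f' ?u) (F.act ?W [f' ?v, f' ?u]) = [f' ?u]" using unch[OF u] by simp
      have "reduced E [f' ?v, f' ?u]" using hom'[OF e] by simp
      then have "reduced E (F.act ?W [f' ?v, f' ?u])" "hd (F.act ?W [f' ?v, f' ?u]) = f' ?v"
        using reduced_act[of "[f' ?v, f' ?u]"] F.walk_hom[OF wW] by auto
      from step_back[OF this(1), of "f' ?u"] this(2) st
      have "F.act ?W [f' ?v, f' ?u] = [f' ?v, f' ?u]" by simp
      from fix_root[OF _ this] show ?thesis by simp
    qed
  qed
  have L1: "F.geodesic k g w = geodesic k g w" if V: "g \<in> VA" "w \<in> VA" "k \<in> VB" and C: "(g, k) \<notin> C" "(w, k) \<notin> C" for g w k
  proof -
    obtain us where us: "even (length us)" "walk A w us g" using walksA[OF V(2,1), of True] by auto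
    obtain k' where k': "(k, k') \<in> B" using nbrB V by blast
    show ?thesis using geodesic_eq[OF tr V(2) us k'] F.geodesic_eq[OF tr' V(2) us k'] unch[OF C(2)]
        same[OF walk_zip_alt[OF us(2,1) k'] C(2,1), of "[f (w, k)]"] by simp
  qed
  \<comment> \<open>The walk is prolonged to a neighbour \<open>g'\<close> outside \<open>C\<close>,
    where old and new actions agree; only the last step back to \<open>g\<close> sees the new
    color.\<close>
  have L2: "F.geodesic h g w = step x2 (step x1 (geodesic h g w))" if g: "g \<in> X" and w: "w \<in> VA" "w \<notin> X" for g w
  proof -
    have gV: "g \<in> VA" using g by (simp add: X_def)
    obtain us where us: "even (length us)" "walk A w us g" using walksA[OF w(1) gV, of True] by auto
    obtain h' where h': "(h, h') \<in> B" using nbrB hga by blast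
    obtain g' where g': "(g, g') \<in> A" using nbrA gV by blast
    let ?W = "zip us (alternate (length us) h' h)"
    have al: "alternate (length us + 2) h' h = alternate (length us) h' h @ [h', h]"
      using us(1) by (simp only: alternate_append) (simp add: numeral_2_eq_2)
    have wc: "(w, h) \<notin> C" using w by (simp add: C_def)
    have e: "((g, h), (g', h')) \<in> prod_edges A B" using g' h' by simp
    have gc: "(g, h) \<in> C" using g by (simp add: C_def)
    then have g'c: "(g', h') \<notin> C" using ind[OF e] by blast
    have wk: "walk (prod_edges A B) (w, h) (?W @ [(g', h')]) (g', h')"
      using walk_zip_alt[OF us(2,1) h'] e by (auto simp: walk_append)
    have "F.geodesic h g w = F.act (zip (us @ [g', g]) (alternate (length (us @ [g', g])) h' h)) [f' (w, h)]"
      using us g' symD[OF symA g'] h' by (intro F.geodesic_eq tr' w) (auto simp: walk_append)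
    also have "\<dots> = step (f' (g, h)) (F.act (?W @ [(g', h')]) [f (w, h)])"
      using al unch[OF wc] by simp
    also have "F.act (?W @ [(g', h')]) [f (w, h)] = act (?W @ [(g', h')]) [f (w, h)]"
      using same[OF wk wc g'c] by simp
    also have "\<dots> = step (f (g', h')) (geodesic h g w)" using geodesic_eq[OF tr w(1) us h'] by simp
    finally show ?thesis using f'_def[of "(g, h)"] gc nbC[OF e gc] by simp
  qed
  \<comment> \<open>Seen from a farthest point, every other lift lies in the direction of
    \<open>x1\<close>; otherwise the geodesic from \<open>w\<close> to \<open>a\<close> would pass
    through that point and be longer than \<open>M\<close>.\<close>
  have inward: "\<exists>r. geodesic h g w = f (g, h) # x1 # r" if g: "g \<in> X" and w: "w \<in> VA" "w \<notin> X" for g w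
  proof -
    have gV: "g \<in> VA" and gx: "geodesic h g a = x" using g by (auto simp: X_def)
    let ?q = "geodesic h g w"
    note q = geodesic_props[OF tr gV w(1) hga(1)]
    have len: "length ?q \<noteq> 1"
    proof
      assume "length ?q = 1"
      then have "?q = [f (w, h)]" using q by (cases ?q) auto
      then have "geodesic h g a = geodesic h w a"
        using geodesic_triangle[OF tr gV w(1) hga(3,1)] reduced_foldl[OF geodesic_props(1)[OF tr w(1) hga(3,1)]]
          geodesic_props(2)[OF tr w(1) hga(3,1)] by simp
      then show False using w gx by (simp add: X_def)
    qed
    then obtain y r where yr: "?q = f (g, h) # y # r" using q by (cases ?q; cases "tl ?q") auto
    have "y = x1"
    proof (rule ccontr)
      assume y: "y \<noteq> x1"
      have x0: "x0 = f (g, h)" using geodesic_props(2)[OF tr gV hga(3,1)] gx xx by simp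
      have "reduced E (rev ?q @ tl x)"
      proof (rule reduced_join)
        show "reduced E (rev ?q)" using q(1) by (simp add: reduced_rev)
        show "reduced E (last (rev ?q) # tl x)" using xr(1) xx x0 yr by (simp add: last_rev)
        have "rev ?q ! (length (rev ?q) - 2) = y" using yr by (simp add: nth_append)
        then show "tl x = [] \<or> length (rev ?q) < 2 \<or> rev ?q ! (length (rev ?q) - 2) \<noteq> hd (tl x)"
          using y xx by simp
      qed
      then have "foldl stepR (rev ?q) (tl x) = rev ?q @ tl x"
        by (rule foldl_stepR_append) (use yr in simp)
      then have "geodesic h w a = rev ?q @ tl x"
        using geodesic_triangle[OF tr w(1) gV hga(3,1)] geodesic_sym[OF tr gV w(1) hga(1)] gx by simp
      then have "length (geodesic h w a) > M" using xr(2) yr M by simp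
      then show False using max[OF hga(1) w(1) hga(3)] by simp
    qed
    with yr show ?thesis by blast
  qed
  have aX: "a \<notin> X" using geodesic_refl[OF tr hga(3,1)] xx by (auto simp: X_def)
  have g1X: "g1 \<in> X" using hga by (simp add: X_def x_def)
  have La: "F.geodesic h g a = x2 # xs" if g: "g \<in> X" for g
    using L2[OF g hga(3) aX] g xx by (simp add: X_def)
  have le2: "length (F.geodesic h g w) \<le> length (geodesic h g w)" if g: "g \<in> X" and w: "w \<in> VA" "w \<notin> X" for g w
  proof -
    obtain r where r: "geodesic h g w = f (g, h) # x1 # r" using inward[OF g w] by blast
    then have "F.geodesic h g w = step x2 (x1 # r)" using L2[OF g w] by simp
    then show ?thesis using r length_step_le[of x2 "x1 # r"] by simp
  qed
  have le: "length (F.geodesic k g w) \<le> length (geodesic k g w)" if V: "k \<in> VB" "g \<in> VA" "w \<in> VA" for k g w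
  proof -
    consider "(g, k) \<notin> C" "(w, k) \<notin> C" | "k = h" "g \<in> X" "w \<notin> X" | "k = h" "g \<notin> X" "w \<in> X"
      | "k = h" "g \<in> X" "w \<in> X" by (auto simp: C_def)
    then show ?thesis
    proof cases
      case 1
      then show ?thesis using L1 V by simp
    next
      case 2
      then show ?thesis using le2 V by simp
    next
      case 3
      then show ?thesis using le2[of w g] V geodesic_sym[OF tr V(2,3,1)] F.geodesic_sym[OF tr' V(2,3,1)] by simp
    next
      case 4
      \<comment> \<open>Both vertices have the same new geodesic to \<open>a\<close>, so a walk
        between them fixes it and acts trivially: they still share a lift.\<close>
      obtain us where us: "even (length us)" "walk A w us g" using walksA[OF V(3,2), of True] by auto
      obtain h' where h': "(h, h') \<in> B" using nbrB hga by blast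
      have "F.act (zip us (alternate (length us) h' h)) (F.geodesic h w a) = F.geodesic h w a"
        using F.geodesic_act[OF tr' V(3) hga(3) us h'] La[OF 4(2)] La[OF 4(3)] by simp
      from fix_root[OF _ this] F.geodesic_props(2)[OF tr' V(3) hga(3,1)]
      have "F.geodesic h g w = [f' (w, h)]"
        using F.geodesic_eq[OF tr' V(3) us h'] La[OF 4(3)] by simp
      then show ?thesis using geodesic_props(1)[OF tr V(2,3,1)] 4(1) by (cases "geodesic k g w") auto
    qed
  qed
  have "F.spread < spread"
    unfolding F.spread_def spread_def
  proof (rule sum_strict_mono_ex1[OF finT])
    show "\<forall>t\<in>?T. (case t of (h, g, w) \<Rightarrow> length (F.geodesic h g w)) \<le> ?l t" using le by auto
    have "length (F.geodesic h g1 a) < length (geodesic h g1 a)" using La[OF g1X] xx by (simp add: x_def[symmetric])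
    then show "\<exists>t\<in>?T. (case t of (h, g, w) \<Rightarrow> length (F.geodesic h g w)) < ?l t"
      using hga by (intro bexI[of _ "(h, g1, a)"]) auto
  qed
  moreover have "\<forall>(u, v)\<in>prod_edges A B. f u = f' u \<or> f v = f' v"
    using ind unch by fastforce
  ultimately show ?thesis using F.tensor_coloring_axioms tr' by blast
qed

end

section \<open>Recoloring towards a cycle\<close>

lemma recoloring_refl: "graph_hom G K f \<Longrightarrow> recoloring_reachable G K f f"
  unfolding recoloring_reachable_def by (rule exI[of _ 0]) auto

lemma recoloring_trans:
  assumes "recoloring_reachable G K f f1" "recoloring_reachable G K f1 f2"
  shows "recoloring_reachable G K f f2"
proof -
  obtain m :: nat and s where s: "s 0 = f" "s m = f1" "\<forall>i\<le>m. graph_hom G K (s i)"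
    "\<forall>i<m. card {v \<in> pverts G. s i v \<noteq> s (Suc i) v} \<le> 1"
    using assms(1) unfolding recoloring_reachable_def by blast
  obtain n :: nat and t where t: "t 0 = f1" "t n = f2" "\<forall>i\<le>n. graph_hom G K (t i)"
    "\<forall>i<n. card {v \<in> pverts G. t i v \<noteq> t (Suc i) v} \<le> 1"
    using assms(2) unfolding recoloring_reachable_def by blast
  define r where "r i = (if i \<le> m then s i else t (i - m))" for i
  have "r (m + n) = f2" using s t by (cases n) (auto simp: r_def)
  moreover have "r 0 = f" using s by (simp add: r_def)
  moreover have "graph_hom G K (r i)" if "i \<le> m + n" for i using s t that by (auto simp: r_def)
  moreover have "card {v \<in> pverts G. r i v \<noteq> r (Suc i) v} \<le> 1" if "i < m + n" for i
  proof -
    consider "i < m" | "i = m" | "i > m" by linarith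
    then show ?thesis
    proof cases
      case 1
      then have "r i = s i" "r (Suc i) = s (Suc i)" by (auto simp: r_def)
      then show ?thesis using s(4) 1 by simp
    next
      case 2
      then have "r i = t 0" "r (Suc i) = t (Suc 0)" using s t by (auto simp: r_def)
      then show ?thesis using t(4) 2 that by simp
    next
      case 3
      then have "r i = t (i - m)" "r (Suc i) = t (Suc (i - m))" by (auto simp: r_def Suc_diff_le)
      moreover have "i - m < n" using 3 that by arith
      ultimately show ?thesis using t(4) by simp
    qed
  qed
  ultimately show ?thesis unfolding recoloring_reachable_def by blast
qed

lemma recoloring_step:
  assumes "graph_hom G K f" "graph_hom G K f'" "card {v \<in> pverts G. f v \<noteq> f' v} \<le> 1"
  shows "recoloring_reachable G K f f'"
  unfolding recoloring_reachable_def
  by (rule exI[of _ 1], rule exI[of _ "\<lambda>i. if i = 0 then f else f'"])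
    (use assms in \<open>auto simp: le_Suc_eq\<close>)

text \<open>The vertices where the colorings differ form an independent set, so they can be changed
  one at a time: on every edge, each mixed coloring agrees with \<open>f\<close> or with
  \<open>f'\<close>.\<close>

lemma recoloring_independent:
  assumes fin: "finite (pverts G)" and sub: "parcs G \<subseteq> pverts G \<times> pverts G"
    and "graph_hom G K f" "graph_hom G K f'"
    and "\<And>u v. (u, v) \<in> parcs G \<Longrightarrow> f u = f' u \<or> f v = f' v"
  shows "recoloring_reachable G K f f'"
  using assms(3-)
proof (induction "card {v \<in> pverts G. f v \<noteq> f' v}" arbitrary: f rule: less_induct)
  case less
  show ?case
  proof (cases "card {v \<in> pverts G. f v \<noteq> f' v} \<le> 1")
    case True
    with less.prems show ?thesis by (intro recoloring_step)
  next
    case False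
    then obtain w where w: "w \<in> pverts G" "f w \<noteq> f' w"
      by (cases "{v \<in> pverts G. f v \<noteq> f' v} = {}") auto
    define g where "g = f(w := f' w)"
    have "graph_hom G K g"
      unfolding graph_hom_def
    proof (intro conjI ballI, safe)
      fix v assume "v \<in> pverts G" then show "g v \<in> pverts K"
        using less.prems by (auto simp: g_def graph_hom_def)
    next
      fix u v assume uv: "(u, v) \<in> parcs G"
      then have "f u = f' u \<or> f v = f' v" "(f u, f v) \<in> parcs K" "(f' u, f' v) \<in> parcs K"
        using less.prems by (auto simp: graph_hom_def)
      then show "(g u, g v) \<in> parcs K" using w by (auto simp: g_def)
    qed
    moreover have "{v \<in> pverts G. g v \<noteq> f' v} \<subset> {v \<in> pverts G. f v \<noteq> f' v}"
      using w by (auto simp: g_def)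
    then have "card {v \<in> pverts G. g v \<noteq> f' v} < card {v \<in> pverts G. f v \<noteq> f' v}"
      using fin by (intro psubset_card_mono) auto
    moreover have "\<And>u v. (u, v) \<in> parcs G \<Longrightarrow> g u = f' u \<or> g v = f' v"
      using less.prems(3) by (auto simp: g_def)
    ultimately have "recoloring_reachable G K g f'" using less.hyps less.prems(2) by simp
    moreover have "{v \<in> pverts G. f v \<noteq> g v} \<subseteq> {w}" by (auto simp: g_def)
    then have "card {v \<in> pverts G. f v \<noteq> g v} \<le> 1"
      using card_mono[of "{w}"] by fastforce
    then have "recoloring_reachable G K f g"
      using less.prems \<open>graph_hom G K g\<close> by (intro recoloring_step)
    ultimately show ?thesis by (rule recoloring_trans[rotated])
  qed
qed

section \<open>Periodic streams and their tails\<close>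

definition stail :: "(nat \<Rightarrow> 'c) \<Rightarrow> nat \<Rightarrow> 'c" where
  "stail s = (\<lambda>i. s (Suc i))"

definition periodic :: "(nat \<Rightarrow> 'c) \<Rightarrow> bool" where
  "periodic s \<longleftrightarrow> (\<exists>m>0. (stail ^^ m) s = s)"

lemma stail_pow: "(stail ^^ n) s i = s (n + i)"
  by (induction n arbitrary: i) (auto simp: stail_def)

lemma stail_pow_comm: "(stail ^^ n) ((stail ^^ m) s) = (stail ^^ (n + m)) s"
  by (simp add: funpow_add)

lemma stail_pow_stail: "(stail ^^ n) (stail s) = stail ((stail ^^ n) s)"
  by (rule funpow_swap1[symmetric])

lemma periodic_tail: "periodic s \<Longrightarrow> periodic (stail s)"
  unfolding periodic_def by (auto simp: stail_pow_stail)

definition preperiod :: "(nat \<Rightarrow> 'c) \<Rightarrow> nat" where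
  "preperiod s = (LEAST i. periodic ((stail ^^ i) s))"

definition eventually_periodic :: "(nat \<Rightarrow> 'c) \<Rightarrow> bool" where
  "eventually_periodic s \<longleftrightarrow> (\<exists>i. periodic ((stail ^^ i) s))"

lemma eventually_periodic_tail: "eventually_periodic (stail s) \<longleftrightarrow> eventually_periodic s"
proof
  assume "eventually_periodic (stail s)"
  then obtain i where "periodic ((stail ^^ i) (stail s))" by (auto simp: eventually_periodic_def)
  then have "periodic ((stail ^^ Suc i) s)" by (simp add: stail_pow_stail)
  then show "eventually_periodic s" unfolding eventually_periodic_def by blast
next
  assume "eventually_periodic s"
  then obtain i where "periodic ((stail ^^ i) s)" by (auto simp: eventually_periodic_def)
  then have "periodic ((stail ^^ i) (stail s))" by (simp add: stail_pow_stail periodic_tail)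
  then show "eventually_periodic (stail s)" unfolding eventually_periodic_def by blast
qed

text \<open>Truncated subtraction covers the periodic streams, whose tails are again
  periodic.\<close>

lemma preperiod_tail: 
  assumes "eventually_periodic s" 
  shows "preperiod (stail s) = preperiod s - 1"
proof -
  have p: "periodic ((stail ^^ preperiod s) s)"
    using assms unfolding eventually_periodic_def preperiod_def by (rule LeastI_ex)
  have le: "preperiod s \<le> i" if "periodic ((stail ^^ i) s)" for i
    unfolding preperiod_def using that by (rule Least_le)
  have sw: "(stail ^^ i) (stail s) = (stail ^^ Suc i) s" for i by (simp add: stail_pow_stail)
  show ?thesis
    unfolding preperiod_def[of "stail s"]
  proof (rule Least_equality)
    show "periodic ((stail ^^ (preperiod s - 1)) (stail s))"
      using p periodic_tail[OF p] sw[of "preperiod s - 1"] by (cases "preperiod s") auto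
  next
    fix i assume "periodic ((stail ^^ i) (stail s))"
    then show "preperiod s - 1 \<le> i" using le[of "Suc i"] sw[of i] by simp
  qed
qed

lemma preperiod_0: "eventually_periodic s \<Longrightarrow> preperiod s = 0 \<Longrightarrow> periodic s"
  unfolding eventually_periodic_def preperiod_def by (metis (mono_tags, lifting) LeastI_ex funpow_0)

text \<open>
  Sending each vertex to a stream and joining a stream to its tail gives a functional graph, in
  which everything can be pushed towards the cycles, that is, to the periodic streams.
\<close>

definition stream_field :: "'v pair_pre_digraph \<Rightarrow> 'c pair_pre_digraph \<Rightarrow> ('v \<Rightarrow> nat \<Rightarrow> 'c) \<Rightarrow> bool" where
  "stream_field P K f \<longleftrightarrow> (\<forall>v\<in>pverts P. eventually_periodic (f v) \<and> (\<forall>i. (f v i, f v (Suc i)) \<in> parcs K)) \<and>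
     (\<forall>(u, v)\<in>parcs P. f v = stail (f u) \<or> f u = stail (f v))"

lemma stream_field_hom:
  assumes "stream_field P K f" "sym (parcs K)" "parcs K \<subseteq> pverts K \<times> pverts K" "parcs P \<subseteq> pverts P \<times> pverts P"
  shows "graph_hom P K (\<lambda>v. f v 0)"
  unfolding graph_hom_def
proof (intro conjI ballI, safe)
  fix v assume "v \<in> pverts P"
  then have "(f v 0, f v (Suc 0)) \<in> parcs K" using assms(1) unfolding stream_field_def by blast
  then show "f v 0 \<in> pverts K" using assms(3) by blast
next
  fix u v assume uv: "(u, v) \<in> parcs P"
  then have "u \<in> pverts P" "v \<in> pverts P" using assms(4) by auto
  then have "(f u 0, f u (Suc 0)) \<in> parcs K" "(f v 0, f v (Suc 0)) \<in> parcs K"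
    using assms(1) unfolding stream_field_def by blast+
  moreover have "f v = stail (f u) \<or> f u = stail (f v)" using assms(1) uv by (auto simp: stream_field_def)
  ultimately show "(f u 0, f v 0) \<in> parcs K"
    using symD[OF assms(2), of "f v 0" "f u 0"] by (auto simp: stail_def)
qed

text \<open>The stream of a vertex with largest positive preperiod is not the tail of a neighbour's
  stream, which would have a larger preperiod. So all neighbours carry its tail, and it may jump to
  its second tail, which is the tail of every neighbour. This lowers the sum of the
  preperiods.\<close>

lemma stream_field_periodic:
  assumes "stream_field P K f" and K: "sym (parcs K)" "parcs K \<subseteq> pverts K \<times> pverts K" 
    and P: "sym (parcs P)" "parcs P \<subseteq> pverts P \<times> pverts P" "finite (pverts P)"
    and irrP: "\<And>v. (v, v) \<notin> parcs P"
  shows "\<exists>f'. stream_field P K f' \<and> recoloring_reachable P K (\<lambda>v. f v 0) (\<lambda>v. f' v 0) \<and>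
     (\<forall>v\<in>pverts P. periodic (f' v))"
  using assms(1)
proof (induction "\<Sum>v\<in>pverts P. preperiod (f v)" arbitrary: f rule: less_induct)
  case less
  show ?case
  proof (cases "\<forall>v\<in>pverts P. periodic (f v)")
    case True
    then show ?thesis using less.prems recoloring_refl[OF stream_field_hom[OF less.prems K P(2)]] by blast
  next
    case False
    then obtain v0 where "v0 \<in> pverts P" "preperiod (f v0) \<noteq> 0"
      using less.prems by (auto simp: stream_field_def dest: preperiod_0)
    moreover have "Max ((\<lambda>u. preperiod (f u)) ` pverts P) \<in> (\<lambda>u. preperiod (f u)) ` pverts P"
      using P(3) calculation by (intro Max_in) auto
    then obtain v where "v \<in> pverts P" "Max ((\<lambda>u. preperiod (f u)) ` pverts P) = preperiod (f v)" by auto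
    then have v: "v \<in> pverts P" "\<And>u. u \<in> pverts P \<Longrightarrow> preperiod (f u) \<le> preperiod (f v)"
      using Max_ge[of "(\<lambda>u. preperiod (f u)) ` pverts P"] P(3) by auto
    ultimately have pos: "preperiod (f v) > 0" by (metis le_zero_eq neq0_conv)
    have nb: "f u = stail (f v)" if "(u, v) \<in> parcs P" for u
    proof (rule ccontr)
      assume "f u \<noteq> stail (f v)"
      then have "f v = stail (f u)" using that less.prems by (auto simp: stream_field_def)
      moreover have "u \<in> pverts P" using that P by auto
      ultimately have "preperiod (f v) = preperiod (f u) - 1" "preperiod (f u) \<le> preperiod (f v)"
        using preperiod_tail[of "f u"] less.prems v by (auto simp: stream_field_def)
      then show False using pos by arith
    qed
    define f' where "f' = f(v := stail (stail (f v)))"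
    have ev: "eventually_periodic (f v)" using less.prems v by (auto simp: stream_field_def)
    have sf: "stream_field P K f'"
      unfolding stream_field_def
    proof (intro conjI ballI, safe)
      fix u assume u: "u \<in> pverts P"
      then show "eventually_periodic (f' u)" using less.prems by (auto simp: f'_def stream_field_def eventually_periodic_tail)
      fix i show "(f' u i, f' u (Suc i)) \<in> parcs K"
        using less.prems u by (auto simp: f'_def stream_field_def stail_def)
    next
      fix a b assume ab: "(a, b) \<in> parcs P" and n: "f' a \<noteq> stail (f' b)"
      have ba: "(b, a) \<in> parcs P" using symD[OF P(1) ab] .
      consider "a = v" "b \<noteq> v" | "b = v" "a \<noteq> v" | "a \<noteq> v" "b \<noteq> v" using ab irrP by blast
      then show "f' b = stail (f' a)"
        using n nb[of a] nb[of b] ab ba less.prems by cases (auto simp: f'_def stream_field_def)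
    qed
    have "preperiod (f' v) < preperiod (f v)"
      using preperiod_tail[OF ev] preperiod_tail[of "stail (f v)"] ev pos by (simp add: f'_def eventually_periodic_tail)
    then have "(\<Sum>v\<in>pverts P. preperiod (f' v)) < (\<Sum>v\<in>pverts P. preperiod (f v))"
      using P(3) v(1) by (intro sum_strict_mono_ex1) (auto simp: f'_def)
    from less.hyps[OF this sf] obtain f'' where f'': "stream_field P K f''"
      "recoloring_reachable P K (\<lambda>v. f' v 0) (\<lambda>v. f'' v 0)" "\<forall>v\<in>pverts P. periodic (f'' v)" by blast
    have "{u \<in> pverts P. f u 0 \<noteq> f' u 0} \<subseteq> {v}" by (auto simp: f'_def)
    then have "card {u \<in> pverts P. f u 0 \<noteq> f' u 0} \<le> 1"
      using card_mono[of "{v}"] by fastforce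
    then have "recoloring_reachable P K (\<lambda>v. f v 0) (\<lambda>v. f' v 0)"
      by (intro recoloring_step stream_field_hom[OF _ K P(2)] less.prems sf)
    with f'' show ?thesis by (blast intro: recoloring_trans)
  qed
qed

text \<open>Each edge adds one tail on one of the two sides, so the walk determines the parity of
  \<open>i + j\<close>. For an odd closed walk this forces \<open>i\<close> and \<open>j\<close> to
  differ, which is the source of periodicity.\<close>

lemma stream_field_walk:
  assumes f: "\<And>u v. (u, v) \<in> R \<Longrightarrow> f v = stail (f u) \<or> f u = stail (f v)"
    and "walk R v W u"
  shows "\<exists>i j. (stail ^^ i) (f v) = (stail ^^ j) (f u) \<and> even (i + j) = even (length W)"
  using assms(2)
proof (induction W arbitrary: v)
  case Nil
  then show ?case by (intro exI[of _ 0]) auto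
next
  case (Cons w W)
  then have "walk R w W u" by simp
  from Cons.IH[OF this] obtain i j where ij: "(stail ^^ i) (f w) = (stail ^^ j) (f u)" "even (i + j) = even (length W)"
    by blast
  have "f w = stail (f v) \<or> f v = stail (f w)" using f Cons.prems by auto
  then show ?case
  proof
    assume "f w = stail (f v)"
    then have "(stail ^^ Suc i) (f v) = (stail ^^ j) (f u)" using ij by (simp add: stail_pow_stail)
    then show ?thesis using ij(2) by (intro exI[of _ "Suc i"] exI[of _ j]) auto
  next
    assume "f v = stail (f w)"
    then have "(stail ^^ i) (f v) = (stail ^^ Suc j) (f u)" using ij by (simp add: stail_pow_stail)
    then show ?thesis using ij(2) by (intro exI[of _ i] exI[of _ "Suc j"]) auto
  qed
qed

text \<open>By connectedness all streams lie on the orbit of one periodic stream \<open>s\<close>.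
  Its least period is the length of the cycle, the position on the orbit is the map to the cycle,
  and \<open>s\<close> itself is the map to \<open>K\<close>.\<close>

lemma periodic_factors_cycle:
  assumes sf: "stream_field P K f" and per: "\<And>v. v \<in> pverts P \<Longrightarrow> periodic (f v)"
    and K: "sym (parcs K)" "parcs K \<subseteq> pverts K \<times> pverts K" "\<And>x. (x, x) \<notin> parcs K"
    and P: "parcs P \<subseteq> pverts P \<times> pverts P"
    and con: "v0 \<in> pverts P" "\<And>v. v \<in> pverts P \<Longrightarrow> \<exists>W. walk (parcs P) v0 W v"
  shows "\<exists>n. proper_graph (cycle_graph n) \<and> factors_through P (cycle_graph n) K (\<lambda>v. f v 0)"
proof -
  define s where "s = f v0"
  define n where "n = (LEAST m. m > 0 \<and> (stail ^^ m) s = s)"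
  have "\<exists>m. m > 0 \<and> (stail ^^ m) s = s" using per[OF con(1)] by (simp add: periodic_def s_def)
  then have n: "n > 0 \<and> (stail ^^ n) s = s" unfolding n_def by (rule LeastI_ex)
  have least: "n \<le> m" if "m > 0" "(stail ^^ m) s = s" for m
    unfolding n_def using that by (intro Least_le) auto
  have mul: "(stail ^^ (q * n)) s = s" for q
    by (induction q) (use n in \<open>auto simp: funpow_add\<close>)
  have md: "(stail ^^ (i mod n)) s = (stail ^^ i) s" for i
  proof -
    have "(stail ^^ (i mod n + i div n * n)) s = (stail ^^ (i mod n)) s" unfolding funpow_add comp_apply mul ..
    then show ?thesis by simp
  qed
  have inj: "i = j" if "i < n" "j < n" "(stail ^^ i) s = (stail ^^ j) s" for i j
    using that
  proof (induction i j rule: linorder_wlog)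
    case (le i j)
    then have "(stail ^^ (n - j)) ((stail ^^ i) s) = (stail ^^ (n - j)) ((stail ^^ j) s)" by simp
    then have "(stail ^^ (n - j + i)) s = (stail ^^ (n - j + j)) s" by (simp only: stail_pow_comm)
    then have "(stail ^^ (n - j + i)) s = s" using le n by simp
    then have "n \<le> n - j + i" using le by (intro least) auto
    then show ?case using le by linarith
  qed simp
  have orb: "\<exists>i. f v = (stail ^^ i) s" if "walk (parcs P) v0 W v" "v \<in> pverts P" for W v
    using that
  proof (induction W arbitrary: v rule: rev_induct)
    case Nil
    then show ?case by (intro exI[of _ 0]) (auto simp: s_def)
  next
    case (snoc w W)
    then obtain u where u: "walk (parcs P) v0 W u" "(u, v) \<in> parcs P" by (auto simp: walk_append)
    then obtain i where i: "f u = (stail ^^ i) s" using snoc.IH[of u] P by auto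
    have "f v = stail (f u) \<or> f u = stail (f v)" using sf u by (auto simp: stream_field_def)
    then show ?case
    proof
      assume "f v = stail (f u)"
      then show ?thesis using i by (intro exI[of _ "Suc i"]) simp
    next
      assume a: "f u = stail (f v)"
      \<comment> \<open>Periodicity allows a tail to be undone by going once around the
        orbit.\<close>
      obtain m where m: "m > 0" "(stail ^^ m) (f v) = f v" using per[OF snoc.prems(2)] by (auto simp: periodic_def)
      then have "f v = (stail ^^ (m - 1)) (stail (f v))" by (cases m) (auto simp: stail_pow_stail)
      also have "\<dots> = (stail ^^ (m - 1 + i)) s" unfolding a[symmetric] i by (rule stail_pow_comm)
      finally show ?thesis by blast
    qed
  qed
  have "\<exists>i<n. f v = (stail ^^ i) s" if v: "v \<in> pverts P" for v
  proof -
    obtain i where "f v = (stail ^^ i) s" using orb con(2)[OF v] v by blast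
    then show ?thesis using md[of i] n by (intro exI[of _ "i mod n"]) auto
  qed
  then obtain c where c: "\<And>v. v \<in> pverts P \<Longrightarrow> c v < n \<and> f v = (stail ^^ c v) s" by metis
  have adj: "(s i, s (Suc i)) \<in> parcs K" for i using sf con by (auto simp: stream_field_def s_def)
  \<comment> \<open>Period 1 would give a loop in \<open>K\<close>; period 2 is allowed, the cycle
    then being a single edge.\<close>
  have "n \<noteq> 1"
  proof
    assume "n = 1"
    then have "stail s = s" using n by simp
    then have "s (Suc 0) = s 0" using fun_cong[of "stail s" s 0] unfolding stail_def by simp
    then show False using adj[of 0] K(3)[of "s 0"] by simp
  qed
  then have "proper_graph (cycle_graph n)" using n by (simp add: proper_graph_cycle_graph)
  moreover have "factors_through P (cycle_graph n) K (\<lambda>v. f v 0)"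
    unfolding factors_through_def
  proof (intro exI[of _ c] exI[of _ s] conjI ballI)
    have nx: "c v = Suc (c u) mod n" if "f v = stail (f u)" "u \<in> pverts P" "v \<in> pverts P" for u v
    proof (rule inj)
      show "(stail ^^ c v) s = (stail ^^ (Suc (c u) mod n)) s"
        using that(1) c[OF that(2)] c[OF that(3)] unfolding md by simp
      show "c v < n" "Suc (c u) mod n < n" using c[OF that(3)] n by simp_all
    qed
    show "graph_hom P (cycle_graph n) c"
      unfolding graph_hom_def
    proof (intro conjI ballI, safe)
      fix v assume "v \<in> pverts P" then show "c v \<in> pverts (cycle_graph n)" using c by (auto simp: cycle_graph_def)
    next
      fix u v assume uv: "(u, v) \<in> parcs P"
      then have V: "u \<in> pverts P" "v \<in> pverts P" using P by auto
      have "f v = stail (f u) \<or> f u = stail (f v)" using sf uv by (auto simp: stream_field_def)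
      then have "c v = Suc (c u) mod n \<or> c u = Suc (c v) mod n" using nx V by blast
      moreover have "c u < n" "c v < n" using c V by blast+
      ultimately show "(c u, c v) \<in> parcs (cycle_graph n)" by (auto simp: cycle_graph_def)
    qed
    have sm: "s (Suc i mod n) = s (Suc i)" for i
      using fun_cong[OF md[of "Suc i"], of 0] unfolding stail_pow by simp
    have "(s i, s (Suc i mod n)) \<in> parcs K" "(s (Suc i mod n), s i) \<in> parcs K" for i
      using adj[of i] symD[OF K(1) adj[of i]] unfolding sm .
    moreover have "s i \<in> pverts K" for i using adj[of i] K(2) by auto
    ultimately show "graph_hom (cycle_graph n) K s"
      by (auto simp: graph_hom_def cycle_graph_def)
    fix v assume "v \<in> pverts P"
    then show "f v 0 = (s \<circ> c) v" using c[of v] stail_pow[of "c v" s 0] by simp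
  qed
  ultimately show ?thesis by blast
qed

lemma stream_field_factors_cycle:
  assumes f: "\<And>v. v \<in> pverts P \<Longrightarrow> f v 0 = \<mu> v" "\<And>v i. v \<in> pverts P \<Longrightarrow> (f v i, f v (Suc i)) \<in> parcs K"
    "\<And>u v. (u, v) \<in> parcs P \<Longrightarrow> f v = stail (f u) \<or> f u = stail (f v)"
    and mu: "graph_hom P K \<mu>"
    and K: "sym (parcs K)" "parcs K \<subseteq> pverts K \<times> pverts K" "\<And>x. (x, x) \<notin> parcs K"
    and P: "sym (parcs P)" "parcs P \<subseteq> pverts P \<times> pverts P" "finite (pverts P)" "pverts P \<noteq> {}"
    and irrP: "\<And>v. (v, v) \<notin> parcs P"
    and con: "\<And>u v c. u \<in> pverts P \<Longrightarrow> v \<in> pverts P \<Longrightarrow> \<exists>W. even (length W) = c \<and> walk (parcs P) u W v"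
  shows "\<exists>\<mu>'. graph_hom P K \<mu>' \<and> recoloring_reachable P K \<mu> \<mu>' \<and>
     (\<exists>n. proper_graph (cycle_graph n) \<and> factors_through P (cycle_graph n) K \<mu>')"
proof -
  have "eventually_periodic (f v)" if v: "v \<in> pverts P" for v
  proof -
    obtain W where "even (length W) = False" "walk (parcs P) v W v" using con[OF v v] by blast
    then obtain i j where ij: "(stail ^^ i) (f v) = (stail ^^ j) (f v)" "odd (i + j)"
      using stream_field_walk[of "parcs P" f v W v] f(3) by auto
    have "eventually_periodic (f v)" if "i < j" "(stail ^^ i) (f v) = (stail ^^ j) (f v)" for i j
    proof -
      have "(stail ^^ (j - i)) ((stail ^^ i) (f v)) = (stail ^^ (j - i + i)) (f v)" by (simp only: stail_pow_comm)
      then have "(stail ^^ (j - i)) ((stail ^^ i) (f v)) = (stail ^^ i) (f v)" using that by simp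
      then show ?thesis unfolding eventually_periodic_def periodic_def using that(1) by (intro exI[of _ i] exI[of _ "j - i"]) auto
    qed
    moreover have "i \<noteq> j" using ij(2) by auto
    ultimately show ?thesis using ij(1) by (metis linorder_neqE_nat)
  qed
  then have sf: "stream_field P K f" using f(2,3) unfolding stream_field_def by blast
  \<comment> \<open>The two maps agree on all vertices but may differ elsewhere, so a recoloring
    step that changes no vertex is taken.\<close>
  have r: "recoloring_reachable P K \<mu> (\<lambda>v. f v 0)"
  proof (rule recoloring_step[OF mu stream_field_hom[OF sf K(1,2) P(2)]])
    have "{v \<in> pverts P. \<mu> v \<noteq> f v 0} = {}" using f(1) by auto
    then show "card {v \<in> pverts P. \<mu> v \<noteq> f v 0} \<le> 1" by (simp only: card.empty)
  qed
  obtain f' where f': "stream_field P K f'" "recoloring_reachable P K (\<lambda>v. f v 0) (\<lambda>v. f' v 0)"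
     "\<And>v. v \<in> pverts P \<Longrightarrow> periodic (f' v)"
    using stream_field_periodic[OF sf K(1,2) P(1-3) irrP] by blast
  obtain v0 where v0: "v0 \<in> pverts P" using P by auto
  have "\<exists>W. walk (parcs P) v0 W v" if "v \<in> pverts P" for v using con[OF v0 that] by blast
  from periodic_factors_cycle[OF f'(1,3) K P(2) v0 this] stream_field_hom[OF f'(1) K(1,2) P(2)]
    recoloring_trans[OF r f'(2)]
  show ?thesis by blast
qed

section \<open>Graphs\<close>

lemma proper_graphD:
  assumes "proper_graph G"
  shows "finite (pverts G)" "finite (parcs G)" "sym (parcs G)" "parcs G \<subseteq> pverts G \<times> pverts G"
    "(x, x) \<notin> parcs G" "v \<in> pverts G \<Longrightarrow> \<exists>w. (v, w) \<in> parcs G" "pverts G \<noteq> {}"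
proof -
  interpret pair_graph G using assms by (simp add: proper_graph_def)
  show "finite (pverts G)" "finite (parcs G)" by (rule pair_finite_verts, rule pair_finite_arcs)
  show "sym (parcs G)" using pair_sym_arcs by (simp add: symmetric_def)
  show "parcs G \<subseteq> pverts G \<times> pverts G" by (auto dest: wellformed')
  show "(x, x) \<notin> parcs G" using pair_no_loops by force
  show "v \<in> pverts G \<Longrightarrow> \<exists>w. (v, w) \<in> parcs G" using assms by (auto simp: proper_graph_def)
  show "pverts G \<noteq> {}" using assms by (auto simp: proper_graph_def)
qed

lemma connected_walk:
  assumes "proper_graph G" "Digraph_Component.connected (with_proj G)" "u \<in> pverts G" "v \<in> pverts G"
  shows "\<exists>us. walk (parcs G) u us v"
proof -
  have "parcs (mk_symmetric (with_proj G)) = parcs G"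
    using proper_graphD(3)[OF assms(1)] by (auto simp: parcs_mk_symmetric sym_def)
  then have "(u, v) \<in> rtrancl_on (pverts G) (parcs G)"
    using assms(2-4) by (auto simp: Digraph_Component.connected_def strongly_connected_def reachable_def)
  then have "(u, v) \<in> (parcs G)\<^sup>*" by (rule rtrancl_on_rtranclI)
  then show ?thesis
  proof (induction rule: converse_rtrancl_induct)
    case base
    show ?case by (intro exI[of _ "[]"]) simp
  next
    case (step y z)
    then obtain us where "walk (parcs G) z us v" by blast
    with step show ?case by (intro exI[of _ "z # us"]) simp
  qed
qed

text \<open>If no vertex were reached from \<open>u\<close> in both parities, parity would be a
  bipartition. Such a vertex gives an odd closed walk at \<open>u\<close>, which corrects the parity
  of any walk.\<close>

lemma nonbipartite_walk:
  assumes G: "proper_graph G" "Digraph_Component.connected (with_proj G)" "\<not> bipartite G"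
    and u: "u \<in> pverts G" and v: "v \<in> pverts G"
  shows "\<exists>us. even (length us) = c \<and> walk (parcs G) u us v"
proof -
  define S where "S c = {y \<in> pverts G. \<exists>us. even (length us) = c \<and> walk (parcs G) u us y}" for c
  note symG = proper_graphD(3)[OF G(1)] and subG = proper_graphD(4)[OF G(1)]
  have cover: "pverts G = S True \<union> S False" using connected_walk[OF G(1,2) u] by (auto simp: S_def)
  have next_S: "y \<in> S (\<not> c)" if "x \<in> S c" "(x, y) \<in> parcs G" for x y c
  proof -
    from that(1) obtain us where us: "even (length us) = c" "walk (parcs G) u us x" by (auto simp: S_def)
    have "walk (parcs G) u (us @ [y]) y" using us that(2) by (auto simp: walk_append)
    moreover have "even (length (us @ [y])) = (\<not> c)" using us by simp
    moreover have "y \<in> pverts G" using that(2) subG by blast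
    ultimately show ?thesis unfolding S_def by blast
  qed
  have "S True \<inter> S False \<noteq> {}"
  proof
    assume d: "S True \<inter> S False = {}"
    have "(x \<in> S True \<and> y \<in> S False) \<or> (x \<in> S False \<and> y \<in> S True)" if "(x, y) \<in> parcs G" for x y
    proof -
      have "x \<in> S True \<or> x \<in> S False" using cover that subG by blast
      then show ?thesis using next_S[of x True y] next_S[of x False y] that by auto
    qed
    then have "\<forall>(x, y)\<in>parcs G. (x \<in> S True \<and> y \<in> S False) \<or> (x \<in> S False \<and> y \<in> S True)" by blast
    with cover d have "bipartite G" unfolding bipartite_def by blast
    with G(3) show False by simp
  qed
  then obtain z us vs where z: "even (length us)" "walk (parcs G) u us z" "odd (length vs)" "walk (parcs G) u vs z"
    by (auto simp: S_def)
  define ws where "ws = us @ rev_walk u vs"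
  have ws: "walk (parcs G) u ws u" "odd (length ws)"
    using z walk_rev_walk[OF symG z(4)] by (auto simp: ws_def walk_append)
  obtain xs where xs: "walk (parcs G) u xs v" using connected_walk[OF G(1,2) u v] by blast
  show ?thesis
  proof (cases "even (length xs) = c")
    case False
    then have "even (length (ws @ xs)) = c" "walk (parcs G) u (ws @ xs) v"
      using ws xs by (auto simp: walk_append)
    then show ?thesis by blast
  qed (use xs in blast)
qed

lemma tensor_product_simps [simp]:
  "pverts (tensor_product G H) = pverts G \<times> pverts H"
  "parcs (tensor_product G H) = prod_edges (parcs G) (parcs H)"
  by (auto simp: tensor_product_def prod_edges_def)

section \<open>Exchanging the two factors\<close>

lemma graph_hom_swap:
  "graph_hom (tensor_product H G) K f \<Longrightarrow> graph_hom (tensor_product G H) K (f \<circ> prod.swap)"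
  by (auto simp: graph_hom_def prod_edges_def)

lemma recoloring_reachable_swap:
  assumes "recoloring_reachable (tensor_product H G) K f f'"
  shows "recoloring_reachable (tensor_product G H) K (f \<circ> prod.swap) (f' \<circ> prod.swap)"
proof -
  obtain m :: nat and s where s: "s 0 = f" "s m = f'" "\<forall>i\<le>m. graph_hom (tensor_product H G) K (s i)"
    "\<forall>i<m. card {v \<in> pverts (tensor_product H G). s i v \<noteq> s (Suc i) v} \<le> 1"
    using assms unfolding recoloring_reachable_def by blast
  have "{v \<in> pverts (tensor_product G H). (s i \<circ> prod.swap) v \<noteq> (s (Suc i) \<circ> prod.swap) v} =
    prod.swap ` {v \<in> pverts (tensor_product H G). s i v \<noteq> s (Suc i) v}" for i
    by (force simp: image_iff)
  then have "card {v \<in> pverts (tensor_product G H). (s i \<circ> prod.swap) v \<noteq> (s (Suc i) \<circ> prod.swap) v} =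
    card {v \<in> pverts (tensor_product H G). s i v \<noteq> s (Suc i) v}" for i
    by (simp only: card_image[OF inj_swap])
  moreover have "\<forall>i\<le>m. graph_hom (tensor_product G H) K (s i \<circ> prod.swap)"
    using s(3) graph_hom_swap by blast
  ultimately show ?thesis unfolding recoloring_reachable_def
    by (intro exI[of _ m] exI[of _ "\<lambda>i. s i \<circ> prod.swap"]) (use s in \<open>simp del: tensor_product_simps\<close>)
qed

lemma factors_through_swap:
  assumes "factors_through (tensor_product H G) I K f"
  shows "factors_through (tensor_product G H) I K (f \<circ> prod.swap)"
proof -
  obtain \<gamma> \<delta> where "graph_hom (tensor_product H G) I \<gamma>" "graph_hom I K \<delta>"
    "\<forall>v\<in>pverts (tensor_product H G). f v = (\<delta> \<circ> \<gamma>) v"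
    using assms unfolding factors_through_def by blast
  then show ?thesis unfolding factors_through_def
    by (intro exI[of _ "\<gamma> \<circ> prod.swap"] exI[of _ \<delta>]) (auto intro: graph_hom_swap)
qed

lemma tensor_coloringI:
  assumes G: "proper_graph G" "Digraph_Component.connected (with_proj G)" "\<not> bipartite G"
    and H: "proper_graph H" "Digraph_Component.connected (with_proj H)" "\<not> bipartite H"
    and K: "proper_graph K" "square_free K"
    and f: "graph_hom (tensor_product G H) K f"
  shows "tensor_coloring (parcs K) (parcs G) (parcs H) (pverts G) (pverts H) f"
proof unfold_locales
  show "a = c \<or> b = d"
    if "(a, b) \<in> parcs K" "(b, c) \<in> parcs K" "(c, d) \<in> parcs K" "(d, a) \<in> parcs K" for a b c d
  proof (rule ccontr)
    assume "\<not> ?thesis"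
    moreover have "a \<noteq> b" "b \<noteq> c" "c \<noteq> d" "d \<noteq> a" using that proper_graphD(5)[OF K(1)] by auto
    ultimately have "distinct [a, b, c, d]" by auto
    with that K(2) show False unfolding square_free_def by blast
  qed
  show "\<exists>us. even (length us) = c \<and> walk (parcs G) g us g'" if "g \<in> pverts G" "g' \<in> pverts G" for g g' c
    using nonbipartite_walk[OF G that] .
  show "\<exists>us. even (length us) = c \<and> walk (parcs H) g us g'" if "g \<in> pverts H" "g' \<in> pverts H" for g g' c
    using nonbipartite_walk[OF H that] .
  show "(f u, f v) \<in> parcs K" if "(u, v) \<in> prod_edges (parcs G) (parcs H)" for u v
    using f that by (auto simp: graph_hom_def)
qed (rule proper_graphD(3-5)[OF G(1)] proper_graphD(3-5)[OF H(1)] proper_graphD(3-5)[OF K(1)])+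

text \<open>The locale speaks only of edges; the values are vertices of \<open>K\<close> because
  every vertex of the product lies on an edge.\<close>

lemma tensor_coloring_hom:
  assumes "tensor_coloring (parcs K) (parcs G) (parcs H) (pverts G) (pverts H) f" "proper_graph K"
  shows "graph_hom (tensor_product G H) K f"
proof -
  interpret tensor_coloring "parcs K" "parcs G" "parcs H" "pverts G" "pverts H" f by (rule assms)
  have "f (g, h) \<in> pverts K" if V: "g \<in> pverts G" "h \<in> pverts H" for g h
  proof -
    obtain g' h' where "(g, g') \<in> parcs G" "(h, h') \<in> parcs H" using nbrA nbrB V by blast
    then have "(f (g, h), f (g', h')) \<in> parcs K" by (intro hom) simp
    then show ?thesis using proper_graphD(4)[OF assms(2)] by blast
  qed
  then show ?thesis using hom by (auto simp: graph_hom_def)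
qed

lemma trivial_factors_through:
  assumes G: "proper_graph G" and H: "proper_graph H" and K: "proper_graph K"
    and "tensor_coloring (parcs K) (parcs G) (parcs H) (pverts G) (pverts H) f"
    and "tensor_coloring.trivialG (parcs G) (parcs H) (pverts G) f"
  shows "\<exists>f'. graph_hom (tensor_product G H) K f' \<and> recoloring_reachable (tensor_product G H) K f f' \<and>
     factors_through (tensor_product G H) H K f'"
  using assms(4,5)
proof (induction "tensor_coloring.spread (parcs G) (parcs H) (pverts G) (pverts H) f" arbitrary: f rule: less_induct)
  case less
  interpret tensor_coloring "parcs K" "parcs G" "parcs H" "pverts G" "pverts H" f by (rule less.prems)
  note tr = less.prems(2)
  note homf = tensor_coloring_hom[OF less.prems(1) K]
  show ?case
  proof (cases "\<exists>h\<in>pverts H. \<exists>g\<in>pverts G. \<exists>w\<in>pverts G. length (geodesic h g w) \<noteq> 1")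
    case True
    then obtain h g w where "h \<in> pverts H" "g \<in> pverts G" "w \<in> pverts G" "length (geodesic h g w) \<noteq> 1" by blast
    from smaller_spread[OF tr proper_graphD(1)[OF G] proper_graphD(1)[OF H] proper_graphD(5)[OF H] this]
    obtain f' where f': "tensor_coloring (parcs K) (parcs G) (parcs H) (pverts G) (pverts H) f'"
      "tensor_coloring.trivialG (parcs G) (parcs H) (pverts G) f'"
      "\<forall>(u, v)\<in>prod_edges (parcs G) (parcs H). f u = f' u \<or> f v = f' v"
      "tensor_coloring.spread (parcs G) (parcs H) (pverts G) (pverts H) f' < spread" by blast
    from less.hyps[OF f'(4,1,2)] obtain f'' where f'': "graph_hom (tensor_product G H) K f''"
      "recoloring_reachable (tensor_product G H) K f' f''" "factors_through (tensor_product G H) H K f''" by blast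
    have "recoloring_reachable (tensor_product G H) K f f'"
    proof (rule recoloring_independent[OF _ _ homf tensor_coloring_hom[OF f'(1) K]])
      show "finite (pverts (tensor_product G H))" using proper_graphD(1)[OF G] proper_graphD(1)[OF H] by simp
      show "parcs (tensor_product G H) \<subseteq> pverts (tensor_product G H) \<times> pverts (tensor_product G H)"
        using subA subB by (auto simp: prod_edges_def)
    qed (use f'(3) in auto)
    with f'' show ?thesis by (blast intro: recoloring_trans)
  next
    case False
    have const: "f (g, h) = f (w, h)" if V: "g \<in> pverts G" "w \<in> pverts G" "h \<in> pverts H" for g w h
    proof -
      have "length (geodesic h g w) = 1" using False V by blast
      then show ?thesis using geodesic_props(2,3)[OF tr V] by (cases "geodesic h g w") auto
    qed
    obtain g0 where g0: "g0 \<in> pverts G" using proper_graphD(7)[OF G] by blast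
    obtain g1 where g1: "(g0, g1) \<in> parcs G" using nbrA g0 by blast
    have g1V: "g1 \<in> pverts G" using g1 subA by auto
    have "factors_through (tensor_product G H) H K f"
      unfolding factors_through_def
    proof (intro exI[of _ snd] exI[of _ "\<lambda>h. f (g0, h)"] conjI ballI)
      show "graph_hom (tensor_product G H) H snd" by (auto simp: graph_hom_def prod_edges_def)
      show "graph_hom H K (\<lambda>h. f (g0, h))" unfolding graph_hom_def
      proof (intro conjI ballI, safe)
        fix h assume "h \<in> pverts H"
        then show "f (g0, h) \<in> pverts K" using homf g0 by (auto simp: graph_hom_def)
      next
        \<comment> \<open>An edge of \<open>H\<close> lifts to the product only together with an
          edge of \<open>G\<close>; constancy of the layer \<open>h'\<close> brings its end back to
          \<open>g0\<close>.\<close>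
        fix h h' assume h: "(h, h') \<in> parcs H"
        then have "(f (g0, h), f (g1, h')) \<in> parcs K" using g1 by (intro hom) simp
        moreover have "f (g1, h') = f (g0, h')" using const[OF g1V g0] h subB by auto
        ultimately show "(f (g0, h), f (g0, h')) \<in> parcs K" by simp
      qed
      fix v assume "v \<in> pverts (tensor_product G H)"
      then show "f v = ((\<lambda>h. f (g0, h)) \<circ> snd) v" using const[OF _ g0] by auto
    qed
    with homf recoloring_refl[OF homf] show ?thesis by blast
  qed
qed

lemma trivialH_swap:
  assumes "tensor_coloring E A B VA VB f" "tensor_coloring E B A VB VA (f \<circ> prod.swap)"
    "tensor_coloring.trivialH A B VB f"
  shows "tensor_coloring.trivialG B A VB (f \<circ> prod.swap)"
proof -
  interpret F: tensor_coloring E A B VA VB f by (rule assms)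
  interpret F': tensor_coloring E B A VB VA "f \<circ> prod.swap" by (rule assms)
  have z: "map (f \<circ> prod.swap) (zip us vs) = map f (zip vs us)" for us vs
    by (subst zip_commute) (auto simp: comp_def split_beta)
  show ?thesis
    using assms(3) unfolding F'.trivialG_def F.trivialH_def z by auto
qed

theorem theorem20:
  fixes G :: "'a pair_pre_digraph" and H :: "'b pair_pre_digraph"
    and K :: "'c pair_pre_digraph" and \<mu> :: "'a \<times> 'b \<Rightarrow> 'c"
  assumes "proper_graph G" and "proper_graph H" and "proper_graph K"
    and "square_free K"
    and "Digraph_Component.connected (with_proj G)" and "\<not> bipartite G"
    and "Digraph_Component.connected (with_proj H)" and "\<not> bipartite H"
    and "graph_hom (tensor_product G H) K \<mu>"
  shows "\<exists>\<mu>'. graph_hom (tensor_product G H) K \<mu>' \<and>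
           recoloring_reachable (tensor_product G H) K \<mu> \<mu>' \<and>
           (factors_through (tensor_product G H) G K \<mu>' \<or>
            factors_through (tensor_product G H) H K \<mu>' \<or>
            (\<exists>n. proper_graph (cycle_graph n) \<and>
                 factors_through (tensor_product G H) (cycle_graph n) K \<mu>'))"
proof -
  note G = assms(1,5,6) and H = assms(2,7,8) and K = assms(3,4)
  have tc: "tensor_coloring (parcs K) (parcs G) (parcs H) (pverts G) (pverts H) \<mu>"
    using tensor_coloringI[OF G H K assms(9)] .
  interpret tensor_coloring "parcs K" "parcs G" "parcs H" "pverts G" "pverts H" \<mu> by (rule tc)
  consider trivialG | trivialH | "\<not> trivialG" "\<not> trivialH" by blast
  then show ?thesis
  proof cases
    case 1
    then show ?thesis using trivial_factors_through[OF assms(1-3) tc] by blast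
  next
    case 2
    have tc': "tensor_coloring (parcs K) (parcs H) (parcs G) (pverts H) (pverts G) (\<mu> \<circ> prod.swap)"
      using tensor_coloringI[OF H G K graph_hom_swap[OF assms(9)]] .
    obtain f where f: "graph_hom (tensor_product H G) K f"
      "recoloring_reachable (tensor_product H G) K (\<mu> \<circ> prod.swap) f" "factors_through (tensor_product H G) G K f"
      using trivial_factors_through[OF assms(2,1,3) tc' trivialH_swap[OF tc tc' 2]] by blast
    have "recoloring_reachable (tensor_product G H) K \<mu> (f \<circ> prod.swap)"
      using recoloring_reachable_swap[OF f(2)] by (simp add: comp_assoc)
    with graph_hom_swap[OF f(1)] factors_through_swap[OF f(3)] show ?thesis by blast
  next
    case 3
    obtain e where "\<forall>v\<in>pverts G \<times> pverts H. reduced_stream (parcs K) (e v) \<and> e v 0 = \<mu> v"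
      and "\<forall>(u, v)\<in>prod_edges (parcs G) (parcs H). e v = stepi (\<mu> v) (e u)"
      using end_field[OF proper_graphD(2)[OF assms(3)] 3] by (elim exE conjE)
    then have e: "\<And>v. v \<in> pverts G \<times> pverts H \<Longrightarrow> reduced_stream (parcs K) (e v) \<and> e v 0 = \<mu> v"
      "\<And>u v. (u, v) \<in> prod_edges (parcs G) (parcs H) \<Longrightarrow> e v = stepi (\<mu> v) (e u)"
      by fast+
    have adj: "e v = stail (e u) \<or> e u = stail (e v)" if "(u, v) \<in> prod_edges (parcs G) (parcs H)" for u v
      using e(2)[OF that] by (auto simp: stepi_def stail_def fun_eq_iff split: if_splits)
    note P = proper_graphD[OF proper_graph_tensor_product[OF assms(1,2)]]
    have "\<exists>\<mu>'. graph_hom (tensor_product G H) K \<mu>' \<and> recoloring_reachable (tensor_product G H) K \<mu> \<mu>' \<and>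
      (\<exists>n. proper_graph (cycle_graph n) \<and> factors_through (tensor_product G H) (cycle_graph n) K \<mu>')"
    proof (rule stream_field_factors_cycle[where f = e, OF _ _ _ assms(9) proper_graphD(3-5)[OF assms(3)] P(3,4,1,7,5)])
      show "\<exists>W. even (length W) = c \<and> walk (parcs (tensor_product G H)) u W v"
        if "u \<in> pverts (tensor_product G H)" "v \<in> pverts (tensor_product G H)" for u v c
        using walks_prod[of u v c] that by simp
    qed (use e(1) adj in \<open>auto simp: reduced_stream_def\<close>)
    then show ?thesis by blast
  qed
qed

end
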